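(* Let $\mathbf I=\mathrm{diag}(I_1,I_2,I_3)$ be the inertia tensor of a satellite with $0<I_i<\tfrac12$ and $I_1+I_2+I_3=1$ which satisfies the Lagrange stability conditions $$I_1>I_3>I_2 .$$ For $R>0$ consider the orthogonal relative equilibrium $((\mathrm{Id},\mathbf R),\xi)$ of the second order system given by $$\mathbf R=(0,R,0),\qquad \xi=(\xi_1,0,0),\qquad \xi_1>0,\qquad \xi_1^2=\frac{1}{R^3}+\frac{3-9I_2}{2R^5}.$$ Then there is a critical value $R_{\mathrm{crit}}>0$ such that this relative equilibrium is $G^{\mathrm{asym}}_\mu$-stable if $R>R_{\mathrm{crit}}$ and linearly unstable if $R<R_{\mathrm{crit}}$. Moreover $R_{\mathrm{crit}}<2$.
   Context: Second order satellite model. Units are chosen so that the satellite has mass $1$ and its inertia tensor has trace $1$. The configuration space is $Q=SO(3)\times(\mathbb R^3\setminus\{0\})$ with points $(B,\mathbf R)$ in body coordinates. Tangent vectors are written $(\Omega,\dot{\mathbf R})\in\mathbb R^3\times\mathbb R^3$ with $\dot B=B\widehat\Omega$, where $\widehat\Omega u=\Omega\times u$. The kinetic energy is $K=\frac12(\Omega\cdot\mathbf I\Omega+|\dot{\mathbf R}+\Omega\times\mathbf R|^2)$, the potential is $$V_2(\mathbf R)=-\frac1R-\frac1{2R^3}+\frac{3}{2R^5}\,\mathbf R\cdot\mathbf I\mathbf R,\qquad R=|\mathbf R|,$$ and the system on $T^*Q$ has Hamiltonian $H_2=K+V_2$. Symmetry. Let $\Gamma=\{\mathrm{diag}(\pm1,\pm1,\pm1)\}$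 and $G^{\mathrm{asym}}=SO(3)\times\Gamma$, acting on $Q$ by $(M,A)\cdot(B,\mathbf R)=(MBA^T\det A,\,A\mathbf R)$ and on $T^*Q$ by cotangent lift; $H_2$ is invariant. The Lie algebra is $\mathfrak{so}(3)\cong\mathbb R^3$ and the momentum map $\mathbf J:T^*Q\to\mathbb R^3$ is the total (spatial) angular momentum; the coadjoint action is $(M,A)\cdot\mu=M\mu$. A relative equilibrium with angular velocity $\xi$ is a point $p\in T^*Q$ whose evolution is $t\mapsto\exp(t\widehat\xi)\cdot p$; a pair $((\mathrm{Id},\mathbf R),\xi)$ denotes the phase space point over $(\mathrm{Id},\mathbf R)$ that is the Legendre transform of the velocity vector $(\Omega,\dot{\mathbf R})=(\xi,0)$. It is called orthogonal if $\mathbf R\cdot\xi=0$. Its momentum is $\mu=(\mathbf I-\widehat{\mathbf R}\widehat{\mathbf R})\xi$, and $G^{\mathrm{asym}}_\mu$ is the stabilizer of $\mu$ for the coadjoint action. Stability. For a symmetry group $G$, a relative equilibrium $p$ with momentum $\mu$ is $G_\mu$-stable if for every $G_\mu$-invariant neighborhood $U$ of the orbit $G_\mu\cdot p$ there is a neighborhood $O$ of $p$ such that the Hamiltonian evolution of $O$ stays in $U$ for all time. It is linearly unstable if the linearization at $p$ of the Hamiltonian vector field of $H_2-\langle\mathbf J,\xi\rangle$, induced on the symplectic slice $\ker d\mathbf J(p)/(\mathfrak g_\mu\cdot p)$, has an eigenvalue with positive real part. *)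

theory Defs
  imports "HOL-Analysis.Analysis"
begin

definition hat :: "real^3 \<Rightarrow> real^3^3" where
  "hat w = matrix (cross3 w)"

lemma hat_mult_vec: "hat w *v u = cross3 w u"
proof -
  have "linear (cross3 w)"
    by (rule linearI) (simp_all add: cross_add_right cross_mult_right)
  then show ?thesis
    unfolding hat_def by (simp add: matrix_works linear_matrix_vector_mul_eq)
qed

definition diag3 :: "real \<Rightarrow> real \<Rightarrow> real \<Rightarrow> real^3^3" where
  "diag3 a b c = (\<chi> i j. if i = j then (vector [a, b, c] :: real^3) $ i else 0)"

definition mexp :: "real^3^3 \<Rightarrow> real^3^3" where
  "mexp A = (\<Sum>n. (1 / fact n) *\<^sub>R ((((**) A) ^^ n) (mat 1)))"


text \<open>
  \<open>T\<^sup>*Q\<close> is left-trivialised: \<open>(B, R, m, P)\<close> is the covector over \<open>(B, R)\<close> whose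
  value on the tangent vector \<open>(\<Omega>, V)\<close>, i.e. \<open>B' = B hat \<Omega>\<close>, \<open>R' = V\<close>, is \<open>m \<bullet> \<Omega> + P \<bullet> V\<close>.
  It is thereby a subset of a Euclidean space.
\<close>

type_synonym phase = "(real^3^3) \<times> (real^3) \<times> (real^3) \<times> (real^3)"
type_synonym triv = "(real^3) \<times> (real^3) \<times> (real^3) \<times> (real^3)"

definition phase_space :: "phase set" where
  "phase_space = {(B, R, m, P). rotation_matrix B \<and> R \<noteq> 0}"

text \<open>
  The tangent vectors at a point of \<open>T\<^sup>*Q\<close> are likewise left-trivialised: \<open>(\<Omega>, r, \<pi>, \<rho>)\<close> stands
  for the ambient vector \<open>(B hat \<Omega>, r, \<pi>, \<rho>)\<close>.
\<close>

fun tangent :: "phase \<Rightarrow> triv \<Rightarrow> phase" where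
  "tangent (B, R, m, P) (\<Omega>, r, \<pi>, \<rho>) = (B ** hat \<Omega>, r, \<pi>, \<rho>)"

text \<open>
  The canonical form \<open>-d\<theta>\<close>, where \<open>\<theta>(\<Omega>, r, \<pi>, \<rho>) = m \<bullet> \<Omega> + P \<bullet> r\<close>. The term with \<open>m\<close> comes from
  the bracket of left-invariant vector fields on \<open>SO(3)\<close>, which is the cross product.
\<close>

fun symp :: "phase \<Rightarrow> triv \<Rightarrow> triv \<Rightarrow> real" where
  "symp (B, R, m, P) (\<Omega>1, r1, \<pi>1, \<rho>1) (\<Omega>2, r2, \<pi>2, \<rho>2) =
     \<pi>2 \<bullet> \<Omega>1 - \<pi>1 \<bullet> \<Omega>2 + m \<bullet> cross3 \<Omega>1 \<Omega>2 + \<rho>2 \<bullet> r1 - \<rho>1 \<bullet> r2"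

lemma symp_nondegenerate:
  fixes f :: "triv \<Rightarrow> real"
  assumes "linear f"
  shows "\<exists>!X. \<forall>Y. symp z X Y = f Y"
proof -
  obtain B R m P where z: "z = (B, R, m, P)" by (cases z) auto
  obtain g1 g2 g3 g4 where g: "adjoint f 1 = (g1, g2, g3, g4)" by (cases "adjoint f 1") auto
  have "f Y = adjoint f 1 \<bullet> Y" for Y
    using adjoint_works[OF assms, of Y 1] by (simp add: inner_commute)
  then have f: "f (a, b, c, d) = g1 \<bullet> a + g2 \<bullet> b + g3 \<bullet> c + g4 \<bullet> d" for a b c d
    by (simp add: g)
  have 1: "symp z (g3, g4, cross3 m g3 - g1, - g2) Y = f Y" for Y
    by (cases Y) (simp add: z f cross3_simps)
  have 2: "X = (g3, g4, cross3 m g3 - g1, - g2)" if X: "\<forall>Y. symp z X Y = f Y" for X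
  proof -
    obtain \<Omega> r \<pi> \<rho> where x: "X = (\<Omega>, r, \<pi>, \<rho>)" by (cases X) auto
    have "\<Omega> \<bullet> c = g3 \<bullet> c" for c
      using X[rule_format, of "(0,0,c,0)"] by (simp add: x z f inner_commute)
    then have a: "\<Omega> = g3" by (meson vector_eq_rdot)
    have "r \<bullet> c = g4 \<bullet> c" for c
      using X[rule_format, of "(0,0,0,c)"] by (simp add: x z f inner_commute)
    then have b: "r = g4" by (meson vector_eq_rdot)
    have "\<rho> \<bullet> c = (- g2) \<bullet> c" for c
      using X[rule_format, of "(0,c,0,0)"] by (simp add: x z f)
    then have c: "\<rho> = - g2" by (meson vector_eq_rdot)
    have "\<pi> \<bullet> e = (cross3 m g3 - g1) \<bullet> e" for e
    proof -
      have "cross3 m g3 \<bullet> e = m \<bullet> cross3 g3 e"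
        by (simp add: cross3_simps)
      then show ?thesis
        using X[rule_format, of "(e,0,0,0)"] by (simp add: x z f a inner_diff_left)
    qed
    then have "\<pi> = cross3 m g3 - g1" by (meson vector_eq_rdot)
    with a b c x show ?thesis by simp
  qed
  show ?thesis using 1 2 by blast
qed

definition ham_vf :: "(phase \<Rightarrow> real) \<Rightarrow> phase \<Rightarrow> triv" where
  "ham_vf f z = (THE X. \<forall>Y. symp z X Y = frechet_derivative f (at z) (tangent z Y))"

definition ham_field :: "(phase \<Rightarrow> real) \<Rightarrow> phase \<Rightarrow> phase" where
  "ham_field f z = tangent z (ham_vf f z)"

definition evolution :: "(phase \<Rightarrow> real) \<Rightarrow> phase \<Rightarrow> (real \<Rightarrow> phase) \<Rightarrow> bool" where
  "evolution f z c \<longleftrightarrow> c 0 = z \<and>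
     (\<forall>t. c t \<in> phase_space \<and> (c has_vector_derivative ham_field f (c t)) (at t))"


text \<open>\<open>I\<close> is the inertia tensor; \<open>V2\<close> presupposes mass 1 and trace 1.\<close>

definition kinetic :: "real^3^3 \<Rightarrow> real^3 \<Rightarrow> (real^3) \<times> (real^3) \<Rightarrow> real" where
  "kinetic I R = (\<lambda>(\<Omega>, V). 1/2 * (\<Omega> \<bullet> (I *v \<Omega>) + (norm (V + cross3 \<Omega> R))\<^sup>2))"

definition V2 :: "real^3^3 \<Rightarrow> real^3 \<Rightarrow> real" where
  "V2 I R = - 1 / norm R - 1 / (2 * norm R ^ 3) + 3 / (2 * norm R ^ 5) * (R \<bullet> (I *v R))"

definition legendre :: "real^3^3 \<Rightarrow> real^3 \<Rightarrow> (real^3) \<times> (real^3) \<Rightarrow> (real^3) \<times> (real^3)" where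
  "legendre I R = (\<lambda>(\<Omega>, V). (I *v \<Omega> + cross3 R (V + cross3 \<Omega> R), V + cross3 \<Omega> R))"

lemma legendre_fibre_derivative:
  assumes "transpose I = I"
  shows "(kinetic I R has_derivative (\<lambda>Y. legendre I R X \<bullet> Y)) (at X)"
proof -
  obtain \<Omega> V where X: "X = (\<Omega>, V)" by (cases X)
  have sym: "a \<bullet> (I *v b) = b \<bullet> (I *v a)" for a b
    by (metis assms dot_lmul_matrix inner_commute transpose_matrix_vector)
  have bl1: "bounded_linear (\<lambda>Y. I *v fst Y)"
    by (intro bounded_linear_compose[OF matrix_vector_mul_bounded_linear] bounded_linear_fst)
  have bl2: "bounded_linear (\<lambda>Y. cross3 (fst Y) R)"
    using bilinear_cross bilinear_conv_bounded_bilinear bounded_bilinear.bounded_linear_left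
      bounded_linear_compose bounded_linear_fst by blast
  have k: "kinetic I R = (\<lambda>Y. 1/2 * (fst Y \<bullet> (I *v fst Y) +
      (snd Y + cross3 (fst Y) R) \<bullet> (snd Y + cross3 (fst Y) R)))"
    by (auto simp: kinetic_def fun_eq_iff power2_norm_eq_inner)
  have tri: "a \<bullet> cross3 R u = u \<bullet> cross3 a R" for u a
    by (simp add: cross3_simps)
  show ?thesis
    unfolding k
    apply (rule has_derivative_eq_rhs)
     apply (rule derivative_eq_intros bounded_linear_imp_has_derivative[OF bl1]
        bounded_linear_imp_has_derivative[OF bl2] refl)+
    apply (auto simp: X legendre_def fun_eq_iff inner_add_left inner_add_right tri inner_commute
        sym[of \<Omega>])
    done
qed

text \<open>The inverse of the Legendre transform, for invertible \<open>I\<close>.\<close>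

definition velocity :: "real^3^3 \<Rightarrow> real^3 \<Rightarrow> (real^3) \<times> (real^3) \<Rightarrow> (real^3) \<times> (real^3)" where
  "velocity I R = (\<lambda>(m, P). let \<Omega> = matrix_inv I *v (m - cross3 R P) in (\<Omega>, P - cross3 \<Omega> R))"

lemma velocity_legendre:
  assumes "invertible I"
  shows "velocity I R (legendre I R X) = X" "legendre I R (velocity I R X) = X"
proof -
  have "I ** matrix_inv I = mat 1 \<and> matrix_inv I ** I = mat 1"
    using assms unfolding invertible_def matrix_inv_def by (rule someI_ex)
  then have "matrix_inv I *v (I *v x) = x" "I *v (matrix_inv I *v x) = x" for x
    by (simp_all add: matrix_vector_mul_assoc)
  then show "velocity I R (legendre I R X) = X" "legendre I R (velocity I R X) = X"
    by (auto simp: velocity_def legendre_def Let_def split: prod.splits)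
qed

definition H2 :: "real^3^3 \<Rightarrow> phase \<Rightarrow> real" where
  "H2 I = (\<lambda>(B, R, m, P). kinetic I R (velocity I R (m, P)) + V2 I R)"


definition Gam :: "(real^3^3) set" where
  "Gam = {diag3 a b c | a b c. a \<in> {-1, 1} \<and> b \<in> {-1, 1} \<and> c \<in> {-1, 1}}"

definition Gasym :: "((real^3^3) \<times> (real^3^3)) set" where
  "Gasym = {(M, A). rotation_matrix M \<and> A \<in> Gam}"

fun act_config :: "(real^3^3) \<times> (real^3^3) \<Rightarrow> (real^3^3) \<times> (real^3) \<Rightarrow> (real^3^3) \<times> (real^3)" where
  "act_config (M, A) (B, R) = (det A *\<^sub>R (M ** B ** transpose A), A *v R)"

text \<open>
  Since \<open>det A *\<^sub>R (M B hat \<Omega> A\<^sup>T)\<close> is \<open>B' hat (det A *\<^sub>R A \<Omega>)\<close> with \<open>B'\<close> the image of \<open>B\<close>, the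
  tangent lift takes \<open>(\<Omega>, V)\<close> to \<open>(det A *\<^sub>R A \<Omega>, A V)\<close>; the cotangent lift, its inverse
  transpose, is given by the same orthogonal maps.
\<close>

fun act :: "(real^3^3) \<times> (real^3^3) \<Rightarrow> phase \<Rightarrow> phase" where
  "act (M, A) (B, R, m, P) =
     (let (B', R') = act_config (M, A) (B, R) in (B', R', det A *\<^sub>R (A *v m), A *v P))"

lemma tangent_lift_rotation:
  assumes A: "orthogonal_matrix A"
  shows "fst (act_config (M, A) (B ** hat w, V)) =
         fst (act_config (M, A) (B, R)) ** hat (det A *\<^sub>R (A *v w))"
proof -
  have TA: "transpose A ** A = mat 1" "A ** transpose A = mat 1"
    using A by (auto simp: orthogonal_matrix_def)
  have "hat (det A *\<^sub>R (A *v w)) *v u = (A ** hat w ** transpose A) *v u" for u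
  proof -
    have "u = A *v (transpose A *v u)" by (simp add: matrix_vector_mul_assoc TA del: transpose_matrix_vector)
    then have "hat (det A *\<^sub>R (A *v w)) *v u = det A *\<^sub>R cross3 (A *v w) (A *v (transpose A *v u))"
      by (simp add: hat_mult_vec cross_mult_left)
    also have "\<dots> = (det A * det A) *\<^sub>R (A *v cross3 w (transpose A *v u))"
      using cross_orthogonal_matrix[OF A] by simp
    also have "det A * det A = 1"
      using det_orthogonal_matrix[OF A] by auto
    finally show ?thesis by (simp add: hat_mult_vec flip: matrix_vector_mul_assoc)
  qed
  then have "hat (det A *\<^sub>R (A *v w)) = A ** hat w ** transpose A"
    by (simp add: matrix_eq)
  moreover have "M ** B ** transpose A ** (A ** hat w ** transpose A) =
      M ** B ** (transpose A ** A) ** hat w ** transpose A"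
    by (simp add: matrix_mul_assoc)
  moreover have scaleR_mult: "(k *\<^sub>R X) ** Y = k *\<^sub>R (X ** Y)" for k and X Y :: "real^3^3"
    by (simp add: matrix_matrix_mult_def vec_eq_iff sum_distrib_left mult.assoc)
  ultimately show ?thesis
    by (simp add: TA scaleR_mult) (simp add: matrix_mul_assoc)
qed

lemma cotangent_lift_pairing:
  assumes A: "orthogonal_matrix A"
  shows "(det A *\<^sub>R (A *v m)) \<bullet> (det A *\<^sub>R (A *v \<Omega>)) + (A *v P) \<bullet> (A *v V) = m \<bullet> \<Omega> + P \<bullet> V"
proof -
  have "(A *v x) \<bullet> (A *v y) = x \<bullet> y" for x y
    using A orthogonal_transformation_matrix[of "(*v) A"]
    by (simp add: orthogonal_transformation_def)
  moreover have "det A * det A = 1"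
    using det_orthogonal_matrix[OF A] by auto
  ultimately show ?thesis
    by (simp flip: mult.assoc)
qed

fun momentum :: "phase \<Rightarrow> real^3" where
  "momentum (B, R, m, P) = B *v m"

fun coad :: "(real^3^3) \<times> (real^3^3) \<Rightarrow> real^3 \<Rightarrow> real^3" where
  "coad (M, A) \<mu> = M *v \<mu>"

definition Gasym_stab :: "real^3 \<Rightarrow> ((real^3^3) \<times> (real^3^3)) set" where
  "Gasym_stab \<mu> = {g \<in> Gasym. coad g \<mu> = \<mu>}"


definition relative_equilibrium :: "real^3^3 \<Rightarrow> phase \<Rightarrow> real^3 \<Rightarrow> bool" where
  "relative_equilibrium I p \<xi> \<longleftrightarrow>
     evolution (H2 I) p (\<lambda>t. act (mexp (t *\<^sub>R hat \<xi>), mat 1) p)"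

definition re_point :: "real^3^3 \<Rightarrow> real^3 \<Rightarrow> real^3 \<Rightarrow> phase" where
  "re_point I R \<xi> = (mat 1, R, legendre I R (\<xi>, 0))"

lemma momentum_re_point:
  "momentum (re_point I R \<xi>) = (I - hat R ** hat R) *v \<xi>"
proof -
  have "cross3 R (cross3 \<xi> R) = - cross3 R (cross3 R \<xi>)"
    by (simp add: cross3_simps)
  then show ?thesis
    by (simp add: re_point_def legendre_def matrix_vector_mult_diff_rdistrib hat_mult_vec
        flip: matrix_vector_mul_assoc)
qed

definition nbhd :: "phase set \<Rightarrow> phase set \<Rightarrow> bool" where
  "nbhd S U \<longleftrightarrow> U \<subseteq> phase_space \<and>
     (\<exists>W. openin (top_of_set phase_space) W \<and> S \<subseteq> W \<and> W \<subseteq> U)"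

text \<open>That the evolution of \<open>z\<close> stays in \<open>U\<close> for all time includes that it exists for all time.\<close>

definition Gmu_stable :: "real^3^3 \<Rightarrow> phase \<Rightarrow> bool" where
  "Gmu_stable I p \<longleftrightarrow> (let G = Gasym_stab (momentum p) in
     \<forall>U. nbhd ((\<lambda>g. act g p) ` G) U \<and> (\<forall>g\<in>G. act g ` U \<subseteq> U) \<longrightarrow>
       (\<exists>N. nbhd {p} N \<and>
          (\<forall>z\<in>N. (\<exists>c. evolution (H2 I) z c) \<and>
                 (\<forall>c. evolution (H2 I) z c \<longrightarrow> (\<forall>t. c t \<in> U)))))"

text \<open>
  For subspaces \<open>W \<subseteq> V\<close> and a linear map \<open>L\<close> preserving both: \<open>\<sigma>\<close> is an eigenvalue of the
  endomorphism of \<open>V / W\<close> induced by \<open>L\<close>; the eigenvector in the complexification of \<open>V / W\<close>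
  is the class of \<open>u + \<i> v\<close>.
\<close>

definition quotient_eigenvalue ::
    "('a::real_vector \<Rightarrow> 'a) \<Rightarrow> 'a set \<Rightarrow> 'a set \<Rightarrow> complex \<Rightarrow> bool" where
  "quotient_eigenvalue L V W \<sigma> \<longleftrightarrow> (\<exists>u\<in>V. \<exists>v\<in>V. (u \<notin> W \<or> v \<notin> W) \<and>
     L u - (Re \<sigma> *\<^sub>R u - Im \<sigma> *\<^sub>R v) \<in> W \<and>
     L v - (Im \<sigma> *\<^sub>R u + Re \<sigma> *\<^sub>R v) \<in> W)"

definition ker_dJ :: "phase \<Rightarrow> phase set" where
  "ker_dJ p = {X \<in> range (tangent p). frechet_derivative momentum (at p) X = 0}"

text \<open>
  The Lie algebra of the stabiliser of \<open>\<mu>\<close> consists of the \<open>\<zeta>\<close> with \<open>\<zeta> \<times> \<mu> = 0\<close>, and the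
  infinitesimal generator of \<open>\<zeta>\<close> is the derivative at \<open>t = 0\<close> of \<open>(exp (t hat \<zeta>) B, R, m, P)\<close>.
\<close>

definition gmu_orbit :: "phase \<Rightarrow> phase set" where
  "gmu_orbit p = {(hat \<zeta> ** fst p, 0, 0, 0) | \<zeta>. cross3 \<zeta> (momentum p) = 0}"

text \<open>
  The vector field is tangent to the phase space and vanishes at a relative equilibrium, so its
  linearization is the restriction to the tangent space of any derivative \<open>L\<close> within the phase
  space; that restriction does not depend on the choice of \<open>L\<close>.
\<close>

definition linearly_unstable :: "real^3^3 \<Rightarrow> phase \<Rightarrow> real^3 \<Rightarrow> bool" where
  "linearly_unstable I p \<xi> \<longleftrightarrow>
     (\<exists>L \<sigma>. (ham_field (\<lambda>z. H2 I z - momentum z \<bullet> \<xi>) has_derivative L) (at p within phase_space) \<and>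
        quotient_eigenvalue L (ker_dJ p) (gmu_orbit p) \<sigma> \<and> Re \<sigma> > 0)"

end

theory Submission
  imports Defs
begin

text \<open>
  The variables \<open>(R, m, P)\<close> obey an autonomous system that conserves the energy and \<open>m \<bullet> m\<close>, and the
  equilibrium is a critical point of \<open>F = h - m \<bullet> m / (2 J) + C / 4 (m \<bullet> m - m0 \<bullet> m0)\<^sup>2\<close> with
  \<open>J = I1 + R\<^sup>2\<close>. For large \<open>C\<close> the Hessian of \<open>F\<close> splits into four blocks, three of which are
  positive definite by the Lagrange conditions; the sign of the determinant of the fourth is that of
  \<open>R\<^sup>4 - (3 I1 + k) R\<^sup>2 - 5 k I1\<close>, \<open>k = (3 - 9 I2) / 2\<close>, whose positive root is \<open>Rcrit\<close> (the value at
  \<open>R = 2\<close> is positive). If it is positive, \<open>F\<close> is a Lyapunov function, and the conserved spatial angular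
  momentum controls the attitude up to the stabiliser. If it is negative, the linearized planar motion
  is \<open>(y, s)'' = M (y, s)\<close> with \<open>det M < 0\<close>, so \<open>M\<close> has a positive eigenvalue.
\<close>


section \<open>Reduced equations of motion\<close>

text \<open>The number \<open>J\<close> is the moment of inertia of the whole configuration about
  the spin axis, so \<open>m0\<close> is \<open>J\<close> times the angular velocity; this is why
  subtracting m.m/(2J) cancels the gradient of the energy. The squared Casimir term leaves that
  gradient alone and alters the Hessian only along \<open>m0\<close>. Completing the square then
  reduces the one block in three variables to its 2x2 part with the first component of
  \<open>m\<close> fixed. The other three blocks are governed by I3 - I2, I1 - I3 and I1 - I2. The
  analytic obstacle is that stability includes existence of evolutions for all time, while the field
  is only locally Lipschitz and singular at R = 0. The field is therefore considered for arbitrary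
  matrices B, cut off by the projection onto a compact convex set and solved globally; conserved
  quantities then show that the solution never leaves that set. One of them must be B B^T, since
  nothing else keeps B orthogonal in the ambient space. For instability an eigenvector modulo the
  orbit directions suffices, so its attitude component can be taken to be zero.\<close>

lemma bounded_bilinear_cross3: "bounded_bilinear cross3"
  using bilinear_conv_bounded_bilinear bilinear_cross by blast

lemma bounded_bilinear_matrix_vector_mult: "bounded_bilinear ((*v) :: real^3^3 \<Rightarrow> real^3 \<Rightarrow> real^3)"
  unfolding bilinear_conv_bounded_bilinear[symmetric] bilinear_def
  by (auto intro!: linearI simp: matrix_vector_right_distrib matrix_vector_mult_scaleR
      matrix_vector_mult_add_rdistrib scaleR_matrix_vector_assoc)

lemma bounded_bilinear_matrix_matrix_mult: "bounded_bilinear ((**) :: real^3^3 \<Rightarrow> real^3^3 \<Rightarrow> real^3^3)"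
  unfolding bilinear_conv_bounded_bilinear[symmetric] bilinear_def
  by (auto intro!: linearI simp: vec_eq_iff matrix_matrix_mult_def sum_3 algebra_simps)

lemma hat_nth:
  "hat w $ 1 $ 1 = 0" "hat w $ 1 $ 2 = - w $ 3" "hat w $ 1 $ 3 = w $ 2"
  "hat w $ 2 $ 1 = w $ 3" "hat w $ 2 $ 2 = 0" "hat w $ 2 $ 3 = - w $ 1"
  "hat w $ 3 $ 1 = - w $ 2" "hat w $ 3 $ 2 = w $ 1" "hat w $ 3 $ 3 = 0"
  by (simp_all add: hat_def matrix_def cross3_def axis_def)

lemma bounded_linear_hat: "bounded_linear hat"
  unfolding linear_conv_bounded_linear[symmetric]
  by (rule linearI) (simp_all add: vec_eq_iff forall_3 hat_nth)

lemma transpose_hat: "transpose (hat w) = - hat w"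
  by (simp add: vec_eq_iff forall_3 hat_nth transpose_def)

lemmas cross3_has_derivative [derivative_intros] =
  bounded_bilinear.FDERIV[OF bounded_bilinear_cross3]
lemmas mult_vec_has_derivative [derivative_intros] =
  bounded_bilinear.FDERIV[OF bounded_bilinear_matrix_vector_mult]
lemmas mult_mat_has_derivative [derivative_intros] =
  bounded_bilinear.FDERIV[OF bounded_bilinear_matrix_matrix_mult]
lemmas hat_has_derivative [derivative_intros] =
  bounded_linear.has_derivative[OF bounded_linear_hat]

lemmas hat_zero [simp] = linear_simps(3)[OF bounded_linear_hat]
lemmas mult_vec_linear = bounded_bilinear.add_left[OF bounded_bilinear_matrix_vector_mult]
  bounded_bilinear.diff_left[OF bounded_bilinear_matrix_vector_mult]
  bounded_bilinear.add_right[OF bounded_bilinear_matrix_vector_mult]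
  bounded_bilinear.diff_right[OF bounded_bilinear_matrix_vector_mult]
lemmas mult_mat_linear = bounded_bilinear.minus_left[OF bounded_bilinear_matrix_matrix_mult]
  bounded_bilinear.minus_right[OF bounded_bilinear_matrix_matrix_mult]
  bounded_bilinear.diff_right[OF bounded_bilinear_matrix_matrix_mult]

lemma matrix_symmetric_inner:
  fixes K :: "real^'n^'n"
  assumes "transpose K = K"
  shows "x \<bullet> (K *v y) = (K *v x) \<bullet> y"
  by (metis assms dot_lmul_matrix transpose_matrix_vector)

definition angvel :: "real^3^3 \<Rightarrow> (real^3) \<times> (real^3) \<times> (real^3) \<Rightarrow> real^3" where
  "angvel I = (\<lambda>(R, m, P). matrix_inv I *v (m - cross3 R P))"

text \<open>Written in powers of the inverse norm, so that every term is a product of factors with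
  ready derivative and Lipschitz rules.\<close>

definition gradV :: "real^3^3 \<Rightarrow> real^3 \<Rightarrow> real^3" where
  "gradV I R = (let q = inverse (norm R) in
     (q^3 + 3/2 * q^5 - 15/2 * q^7 * (R \<bullet> (I *v R))) *\<^sub>R R + (3 * q^5) *\<^sub>R (I *v R))"

definition energy :: "real^3^3 \<Rightarrow> (real^3) \<times> (real^3) \<times> (real^3) \<Rightarrow> real" where
  "energy I = (\<lambda>(R, m, P). 1/2 * (angvel I (R, m, P) \<bullet> (m - cross3 R P) + P \<bullet> P) + V2 I R)"

definition grad_energy :: "real^3^3 \<Rightarrow> (real^3) \<times> (real^3) \<times> (real^3) \<Rightarrow> (real^3) \<times> (real^3) \<times> (real^3)" where
  "grad_energy I = (\<lambda>(R, m, P). let \<Omega> = angvel I (R, m, P) in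
     (gradV I R - cross3 P \<Omega>, \<Omega>, P - cross3 \<Omega> R))"

text \<open>An explicit form of the Hamiltonian field that makes sense for every matrix
  \<open>B\<close>, so that it can be cut off and integrated in the ambient Euclidean space.\<close>

definition sat_field :: "real^3^3 \<Rightarrow> phase \<Rightarrow> phase" where
  "sat_field I = (\<lambda>(B, R, m, P). let \<Omega> = angvel I (R, m, P) in
     (B ** hat \<Omega>, P - cross3 \<Omega> R, cross3 m \<Omega>, cross3 P \<Omega> - gradV I R))"

lemma inverse_norm_has_derivative:
  fixes x :: "'a::real_inner"
  assumes "x \<noteq> 0"
  shows "((\<lambda>x. inverse (norm x)) has_derivative (\<lambda>h. - (inverse (norm x) ^ 3 * (x \<bullet> h)))) (at x)"
  by (rule has_derivative_eq_rhs)
    (use assms in \<open>auto intro!: derivative_eq_intros has_derivative_norm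
       simp: sgn_div_norm inner_commute power3_eq_cube fun_eq_iff\<close>)

lemma V2_has_derivative:
  assumes I: "transpose I = I" and R: "R \<noteq> 0"
  shows "(V2 I has_derivative (\<lambda>h. gradV I R \<bullet> h)) (at R)"
proof -
  have V: "V2 I = (\<lambda>R. - (inverse (norm R)) - 1/2 * inverse (norm R) ^ 3
      + 3/2 * inverse (norm R) ^ 5 * (R \<bullet> (I *v R)))"
    by (simp add: V2_def fun_eq_iff field_simps)
  show ?thesis
    unfolding V
    apply (rule has_derivative_eq_rhs)
     apply (rule inverse_norm_has_derivative R derivative_eq_intros refl)+
    by (simp add: fun_eq_iff gradV_def Let_def inner_add_left matrix_symmetric_inner[OF I, of R]
       inner_commute[of _ "I *v R"] eval_nat_numeral field_simps)
qed


lemma H2_eq_energy: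
  assumes "invertible I"
  shows "H2 I (B, y) = energy I y"
proof -
  obtain R m P where y: "y = (R, m, P)" by (cases y)
  have "I ** matrix_inv I = mat 1"
    using assms unfolding invertible_def matrix_inv_def by (metis (mono_tags, lifting) someI_ex)
  then have "I *v (matrix_inv I *v x) = x" for x
    by (simp add: matrix_vector_mul_assoc)
  then show ?thesis
    by (simp add: y H2_def kinetic_def velocity_def energy_def angvel_def Let_def power2_norm_eq_inner)
qed

lemma transpose_matrix_inv:
  fixes I :: "real^'n^'n"
  assumes I: "transpose I = I" and inv: "invertible I"
  shows "transpose (matrix_inv I) = matrix_inv I"
proof -
  have "I ** matrix_inv I = mat 1 \<and> matrix_inv I ** I = mat 1"
    using inv unfolding invertible_def matrix_inv_def by (rule someI_ex)
  then have 1: "I ** matrix_inv I = mat 1" by blast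
  have "transpose (matrix_inv I) ** I = mat 1"
    by (metis 1 I matrix_transpose_mul transpose_mat)
  then show ?thesis
    by (metis 1 matrix_mul_assoc matrix_mul_lid matrix_mul_rid)
qed

lemma energy_has_derivative:
  assumes I: "transpose I = I" "invertible I" and R: "fst y \<noteq> 0"
  shows "(energy I has_derivative (\<lambda>h. grad_energy I y \<bullet> h)) (at y)"
proof -
  obtain R m P where y: "y = (R, m, P)" by (cases y)
  have R: "R \<noteq> 0" using R y by simp
  let ?K = "matrix_inv I"
  have sK: "x \<bullet> (?K *v z) = (?K *v x) \<bullet> z" for x z
    by (rule matrix_symmetric_inner[OF transpose_matrix_inv[OF I]])
  have e: "energy I = (\<lambda>y. 1/2 * ((?K *v (fst (snd y) - cross3 (fst y) (snd (snd y)))) \<bullet>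
      (fst (snd y) - cross3 (fst y) (snd (snd y))) + snd (snd y) \<bullet> snd (snd y)) + V2 I (fst y))"
    by (simp add: energy_def angvel_def fun_eq_iff)
  have V: "((\<lambda>y. V2 I (fst y)) has_derivative (\<lambda>h. gradV I R \<bullet> fst h)) (at y)"
    using has_derivative_compose[of fst fst y UNIV "V2 I"] V2_has_derivative[OF I(1) R]
    by (simp add: y bounded_linear_imp_has_derivative bounded_linear_fst)
  have c: "v \<bullet> cross3 a b = a \<bullet> cross3 b v" for a b v
    by (simp add: cross3_simps)
  show ?thesis
    unfolding e
    apply (rule has_derivative_eq_rhs)
     apply (rule V derivative_eq_intros refl)+
    apply (rule ext)
    subgoal for h
    proof -
      obtain r a p where h: "h = (r, a, p)" by (cases h)
      define W where "W = ?K *v (m - cross3 R P)"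
      define l where "l = a - (cross3 R p + cross3 r P)"
      \<comment> \<open>Symmetry of the inverse inertia tensor makes the two product-rule terms
        equal, which cancels the factor 1/2; \<open>2\<close> then sorts the result by direction
        using cyclic triple products.\<close>
      have 1: "(?K *v l) \<bullet> (m - cross3 R P) = W \<bullet> l"
        by (metis W_def inner_commute sK)
      have 2: "W \<bullet> l = W \<bullet> a - p \<bullet> cross3 W R - r \<bullet> cross3 P W"
        by (simp add: l_def inner_diff_right inner_add_right c[of W r P] c[of W R p] c[of R p W])
      show ?thesis
        using 1 2
        by (simp add: h y grad_energy_def angvel_def Let_def flip: W_def l_def)
          (simp add: inner_diff_right inner_commute[of _ r] inner_commute[of _ p] field_simps)
    qed
    done
qed

text \<open>Nondegeneracy of the symplectic form makes the definite description unique, so a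
  Hamiltonian field is computed by guessing it and checking the pairing.\<close>

lemma ham_vf_eqI:
  assumes "(f has_derivative D) (at z)" and "\<And>Y. symp z X Y = D (tangent z Y)"
  shows "ham_vf f z = X"
proof -
  have D: "frechet_derivative f (at z) = D"
    using assms(1) by (rule frechet_derivative_at[symmetric])
  have "X' = X" if "\<forall>Y. symp z X' Y = D (tangent z Y)" for X'
  proof -
    have "linear (symp z X)"
      by (cases z, cases X, rule linearI)
        (auto simp: inner_add_left inner_add_right cross_add_right cross_mult_right algebra_simps)
    from symp_nondegenerate[OF this, of z] have "\<exists>!X'. \<forall>Y. symp z X' Y = D (tangent z Y)"
      by (simp only: assms(2))
    then show ?thesis using that assms(2) by blast
  qed
  then show ?thesis
    unfolding ham_vf_def D using assms(2) by (intro the_equality) auto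
qed

lemma momentum_has_derivative:
  "(momentum has_derivative (\<lambda>(b, r, a, p). b *v m + B *v a)) (at (B, R, m, P))"
proof -
  have e: "momentum = (\<lambda>z. fst z *v fst (snd (snd z)))"
    by (auto simp: fun_eq_iff)
  show ?thesis
    unfolding e
    apply (rule has_derivative_eq_rhs)
     apply (rule derivative_eq_intros refl)+
    by (auto simp: fun_eq_iff)
qed

lemma H2_has_derivative:
  assumes I: "transpose I = I" "invertible I" and R: "fst y \<noteq> 0"
  shows "(H2 I has_derivative (\<lambda>h. grad_energy I y \<bullet> snd h)) (at (B, y))"
proof -
  have "H2 I = (\<lambda>z. energy I (snd z))"
    by (auto simp: fun_eq_iff H2_eq_energy[OF I(2)])
  then show ?thesis
    using has_derivative_compose[of snd snd "(B, y)" UNIV "energy I"] energy_has_derivative[OF I R]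
    by (simp add: bounded_linear_imp_has_derivative bounded_linear_snd)
qed

lemma ham_field_H2:
  assumes I: "transpose I = I" "invertible I" and R: "fst (snd z) \<noteq> 0"
  shows "ham_field (H2 I) z = sat_field I z"
proof -
  obtain B R m P where z: "z = (B, R, m, P)" by (cases z)
  define W where "W = angvel I (R, m, P)"
  have "ham_vf (H2 I) z = (W, P - cross3 W R, cross3 m W, cross3 P W - gradV I R)"
    unfolding z
  proof (rule ham_vf_eqI)
    show "(H2 I has_derivative (\<lambda>h. grad_energy I (R, m, P) \<bullet> snd h)) (at (B, R, m, P))"
      using H2_has_derivative[OF I] R z by auto
    show "symp (B, R, m, P) (W, P - cross3 W R, cross3 m W, cross3 P W - gradV I R) Y =
      grad_energy I (R, m, P) \<bullet> snd (tangent (B, R, m, P) Y)" for Y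
      by (cases Y) (simp add: grad_energy_def flip: W_def, simp add: cross3_simps)
  qed
  then show ?thesis
    by (simp add: ham_field_def z sat_field_def flip: W_def)
qed

text \<open>The flow of the momentum component along \<open>\<xi>\<close> moves only the attitude,
  and its angular velocity seen in the body frame is \<open>transpose B *v \<xi>\<close>. Hence the
  other three components agree with those for \<open>H2\<close>.\<close>

lemma ham_field_augmented:
  assumes I: "transpose I = I" "invertible I" and R: "R \<noteq> 0" and W_def: "W = angvel I (R, m, P)"
  shows "ham_field (\<lambda>z. H2 I z - momentum z \<bullet> \<xi>) (B, R, m, P) =
    (B ** hat (W - transpose B *v \<xi>), P - cross3 W R, cross3 m W, cross3 P W - gradV I R)"
proof -
  define \<eta> where "\<eta> = transpose B *v \<xi>"
  have \<eta>: "(B *v x) \<bullet> \<xi> = x \<bullet> \<eta>" for x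
    unfolding \<eta>_def by (metis dot_lmul_matrix inner_commute transpose_matrix_vector)
  have "ham_vf (\<lambda>z. H2 I z - momentum z \<bullet> \<xi>) (B, R, m, P) =
    (W - \<eta>, P - cross3 W R, cross3 m W, cross3 P W - gradV I R)"
  proof (rule ham_vf_eqI)
    show "((\<lambda>z. H2 I z - momentum z \<bullet> \<xi>) has_derivative
      (\<lambda>h. grad_energy I (R, m, P) \<bullet> snd h - (case h of (b, r, a, p) \<Rightarrow> b *v m + B *v a) \<bullet> \<xi>)) (at (B, R, m, P))"
      using R by (intro has_derivative_diff H2_has_derivative[OF I] has_derivative_inner_left
          momentum_has_derivative) auto
    show "symp (B, R, m, P) (W - \<eta>, P - cross3 W R, cross3 m W, cross3 P W - gradV I R) Y =
      grad_energy I (R, m, P) \<bullet> snd (tangent (B, R, m, P) Y) -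
      (case tangent (B, R, m, P) Y of (b, r, a, p) \<Rightarrow> b *v m + B *v a) \<bullet> \<xi>" for Y
      by (cases Y) (simp add: grad_energy_def hat_mult_vec inner_add_left \<eta> flip: W_def matrix_vector_mul_assoc,
         simp add: cross3_simps)
  qed
  then show ?thesis
    by (simp add: ham_field_def W_def \<eta>_def)
qed


section \<open>The relative equilibrium\<close>

lemma diag3_nth: "diag3 a b c $ 1 $ 1 = a" "diag3 a b c $ 1 $ 2 = 0" "diag3 a b c $ 1 $ 3 = 0"
  "diag3 a b c $ 2 $ 1 = 0" "diag3 a b c $ 2 $ 2 = b" "diag3 a b c $ 2 $ 3 = 0"
  "diag3 a b c $ 3 $ 1 = 0" "diag3 a b c $ 3 $ 2 = 0" "diag3 a b c $ 3 $ 3 = c"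
  by (simp_all add: diag3_def)

lemma diag3_mult_vec: "diag3 a b c *v x = vector [a * x $ 1, b * x $ 2, c * x $ 3]"
  by (simp add: vec_eq_iff forall_3 matrix_vector_mult_def sum_3 diag3_nth)

lemma transpose_diag3: "transpose (diag3 a b c) = diag3 a b c"
  by (simp add: vec_eq_iff forall_3 transpose_def diag3_nth)

lemma diag3_mult: "diag3 a b c ** diag3 a' b' c' = diag3 (a * a') (b * b') (c * c')"
  by (simp add: vec_eq_iff forall_3 matrix_matrix_mult_def sum_3 diag3_nth)

lemma diag3_one: "diag3 1 1 1 = mat 1"
  by (simp add: vec_eq_iff forall_3 mat_def diag3_nth)

lemma invertible_diag3:
  assumes "a \<noteq> 0" "b \<noteq> 0" "c \<noteq> 0"
  shows "invertible (diag3 a b c)"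
  unfolding invertible_def
  by (rule exI[of _ "diag3 (1/a) (1/b) (1/c)"]) (use assms in \<open>simp add: diag3_mult diag3_one\<close>)

lemma matrix_inv_diag3:
  assumes "a \<noteq> 0" "b \<noteq> 0" "c \<noteq> 0"
  shows "matrix_inv (diag3 a b c) = diag3 (1/a) (1/b) (1/c)"
proof -
  have "diag3 a b c ** matrix_inv (diag3 a b c) = mat 1 \<and> matrix_inv (diag3 a b c) ** diag3 a b c = mat 1"
    using invertible_diag3[OF assms] unfolding invertible_def matrix_inv_def by (rule someI_ex)
  moreover have "diag3 a b c ** diag3 (1/a) (1/b) (1/c) = mat 1"
    using assms by (simp add: diag3_mult diag3_one)
  ultimately show ?thesis
    by (metis matrix_mul_assoc matrix_mul_lid matrix_mul_rid)
qed

text \<open>The matrix of \<open>(x, \<zeta>) \<mapsto> (d x, z \<zeta>)\<close> on \<open>\<real> \<times> \<complex>\<close>.\<close>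

definition block_mat :: "complex \<Rightarrow> real \<Rightarrow> real^3^3" where
  "block_mat z d = vector [vector [d, 0, 0], vector [0, Re z, - Im z], vector [0, Im z, Re z]]"

lemma block_mat_mult: "block_mat z d ** block_mat z' d' = block_mat (z * z') (d * d')"
  by (simp add: vec_eq_iff forall_3 matrix_matrix_mult_def sum_3 block_mat_def)

lemma block_mat_one: "block_mat 1 1 = mat 1"
  by (simp add: vec_eq_iff forall_3 mat_def block_mat_def)

lemma block_mat_hat: "hat (vector [w, 0, 0]) = block_mat (\<i> * of_real w) 0"
  by (simp add: vec_eq_iff forall_3 hat_nth block_mat_def)

lemma scaleR_block_mat: "t *\<^sub>R block_mat z d = block_mat (t *\<^sub>R z) (t * d)"
  by (simp add: vec_eq_iff forall_3 block_mat_def)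

lemma block_mat_add: "block_mat z d + block_mat z' d' = block_mat (z + z') (d + d')"
  by (simp add: vec_eq_iff forall_3 block_mat_def)

lemma bounded_linear_block_mat:
  "bounded_linear (\<lambda>z. block_mat z 0)" "bounded_linear (block_mat 0)"
  unfolding linear_conv_bounded_linear[symmetric]
  by (auto intro!: linearI simp: block_mat_add scaleR_block_mat)

lemma block_mat_power:
  "(((**) (block_mat z d)) ^^ n) (mat 1) = block_mat (z ^ n) (d ^ n)"
  by (induction n) (simp_all add: block_mat_one block_mat_mult)

lemma mexp_hat_axis1: "mexp (t *\<^sub>R hat (vector [w, 0, 0])) = block_mat (cis (t * w)) 1"
proof -
  define z where "z = t *\<^sub>R (\<i> * of_real w)"
  \<comment> \<open>The exponential series splits into a complex one and a real one. The real one
    has terms 0^n / n!, whose n = 0 term is 1, so it contributes the fixed axis.\<close>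
  have "(\<lambda>n. block_mat (z ^ n /\<^sub>R fact n) 0 + block_mat 0 (0 ^ n /\<^sub>R fact n)) sums
      (block_mat (exp z) 0 + block_mat 0 (exp 0))"
    by (rule sums_add[OF bounded_linear.sums[OF bounded_linear_block_mat(1) exp_converges[of z]]
          bounded_linear.sums[OF bounded_linear_block_mat(2) exp_converges[of 0]]])
  also have "exp z = cis (t * w)"
    by (simp add: z_def cis_conv_exp scaleR_conv_of_real mult_ac)
  finally have "(\<lambda>n. block_mat (z ^ n /\<^sub>R fact n) (0 ^ n /\<^sub>R fact n)) sums block_mat (cis (t * w)) 1"
    by (simp add: block_mat_add)
  then show ?thesis
    unfolding mexp_def block_mat_hat scaleR_block_mat block_mat_power
    by (simp add: sums_iff z_def divide_inverse scaleR_conv_of_real mult_ac)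
qed

lemma rotation_matrix_block_cis: "rotation_matrix (block_mat (cis \<theta>) 1)"
proof -
  have "transpose (block_mat (cis \<theta>) 1) = block_mat (cis (- \<theta>)) 1"
    by (simp add: vec_eq_iff forall_3 transpose_def block_mat_def)
  then have "orthogonal_matrix (block_mat (cis \<theta>) 1)"
    by (simp add: orthogonal_matrix block_mat_mult cis_mult block_mat_one)
  moreover have "det (block_mat (cis \<theta>) 1) = 1"
    by (simp add: det_3 block_mat_def flip: power2_eq_square)
  ultimately show ?thesis by (simp add: rotation_matrix_def)
qed

locale satellite =
  fixes I1 I2 I3 r w :: real
  assumes I_pos: "0 < I1" "0 < I2" "0 < I3"
    and r_pos: "0 < r" and w_pos: "0 < w"
    and w_sq: "w\<^sup>2 = 1 / r^3 + (3 - 9 * I2) / (2 * r^5)"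
begin

definition Inert :: "real^3^3" where "Inert = diag3 I1 I2 I3"
definition R0 :: "real^3" where "R0 = vector [0, r, 0]"
definition m0 :: "real^3" where "m0 = vector [(I1 + r\<^sup>2) * w, 0, 0]"
definition P0 :: "real^3" where "P0 = vector [0, 0, r * w]"
definition \<xi> :: "real^3" where "\<xi> = vector [w, 0, 0]"

lemma Inert_sym: "transpose Inert = Inert" and Inert_inv: "invertible Inert"
  using I_pos by (simp_all add: Inert_def transpose_diag3 invertible_diag3)

lemma inv_Inert: "matrix_inv Inert = diag3 (1/I1) (1/I2) (1/I3)"
  using I_pos by (simp add: Inert_def matrix_inv_diag3)

lemma R0_nonzero [simp]: "R0 \<noteq> 0"
  using r_pos by (simp add: R0_def vec_eq_iff forall_3)

lemma norm_R0: "norm R0 = r"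
  using r_pos by (simp add: R0_def norm_eq_sqrt_inner inner_vec_def sum_3)

lemma re_point_eq: "re_point Inert R0 \<xi> = (mat 1, R0, m0, P0)"
  by (simp add: re_point_def legendre_def Inert_def R0_def m0_def P0_def \<xi>_def diag3_mult_vec
      vec_eq_iff forall_3 cross3_def algebra_simps power2_eq_square)

lemma angvel_0: "angvel Inert (R0, m0, P0) = \<xi>"
  using I_pos by (simp add: angvel_def inv_Inert R0_def m0_def P0_def \<xi>_def diag3_mult_vec
      vec_eq_iff forall_3 cross3_def field_simps power2_eq_square)

text \<open>This is the radial force balance: \<open>w_sq\<close> states exactly that the
  gravitational force supplies the centripetal acceleration \<open>r * w\<^sup>2\<close>.\<close>

lemma gradV_0: "gradV Inert R0 = cross3 P0 \<xi>"
proof -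
  have "r * w\<^sup>2 = (1 / r) ^ 3 * r + 3/2 * (1 / r)^5 * r - 15/2 * (1/r)^7 * (r * (I2 * r)) * r + 3 * (1/r)^5 * (I2 * r)"
    using r_pos unfolding w_sq by (simp add: field_simps eval_nat_numeral)
  then show ?thesis
    by (simp add: gradV_def norm_R0 Let_def, simp add: R0_def P0_def \<xi>_def Inert_def diag3_mult_vec
      vec_eq_iff forall_3 cross3_def inner_vec_def sum_3 inverse_eq_divide algebra_simps power2_eq_square)
qed

lemma equilibrium_fixed:
  "cross3 \<xi> R0 = P0" "cross3 m0 \<xi> = 0" "momentum (mat 1, R0, m0, P0) = m0"
  by (simp_all add: R0_def P0_def m0_def \<xi>_def vec_eq_iff forall_3 cross3_def)

lemma relative_equilibrium: "relative_equilibrium Inert (re_point Inert R0 \<xi>) \<xi>"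
proof -
  define c where "c t = (block_mat (cis (t * w)) 1, R0, m0, P0)" for t
  have c: "(\<lambda>t. act (mexp (t *\<^sub>R hat \<xi>), mat 1) (re_point Inert R0 \<xi>)) = c"
    by (simp add: fun_eq_iff re_point_eq, simp add: \<xi>_def mexp_hat_axis1 c_def transpose_mat)
  have phase: "c t \<in> phase_space" for t
    by (simp add: c_def phase_space_def rotation_matrix_block_cis)
  have "ham_field (H2 Inert) (c t) = sat_field Inert (c t)" for t
    by (rule ham_field_H2) (simp_all add: Inert_sym Inert_inv c_def)
  also have "sat_field Inert (c t) = (block_mat (cis (t * w)) 1 ** hat \<xi>, 0, 0, 0)" for t
    using equilibrium_fixed(1,2) by (simp add: c_def sat_field_def angvel_0 gradV_0)
  also have "block_mat (cis (t * w)) 1 ** hat \<xi> = block_mat (of_real w * (\<i> * cis (t * w))) 0" for t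
    by (simp add: \<xi>_def block_mat_hat block_mat_mult mult_ac)
  finally have f: "ham_field (H2 Inert) (c t) = (block_mat (of_real w * (\<i> * cis (t * w))) 0, 0, 0, 0)" for t .
  have "((\<lambda>t. cis (t * w)) has_vector_derivative of_real w * (\<i> * cis (t * w))) (at t)" for t
    unfolding cis_conv_exp
    by (rule has_vector_derivative_eq_rhs)
      (auto intro!: derivative_eq_intros has_vector_derivative_real_field simp: mult_ac)
  then have "((\<lambda>t. block_mat (cis (t * w)) 0 + block_mat 0 1) has_vector_derivative
      block_mat (of_real w * (\<i> * cis (t * w))) 0 + 0) (at t)" for t
    by (intro has_vector_derivative_add has_vector_derivative_const
        bounded_linear.has_vector_derivative[OF bounded_linear_block_mat(1)])
  then have "(c has_vector_derivative ham_field (H2 Inert) (c t)) (at t)" for t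
    unfolding f unfolding c_def
    by (intro has_vector_derivative_Pair has_vector_derivative_const) (simp add: block_mat_add)
  moreover have "c 0 = re_point Inert R0 \<xi>"
    by (simp add: c_def re_point_eq block_mat_one)
  ultimately show ?thesis
    unfolding relative_equilibrium_def c evolution_def using phase by auto
qed

end


section \<open>Global solutions of Lipschitz differential equations\<close>

text \<open>Weighting by exp (- l t) gains a factor 1 / l uniformly in t. With \<open>C\<close> the
  Lipschitz constant times a distance this is the contraction estimate on an unbounded time
  interval.\<close>

lemma norm_exp_weighted_integral_le:
  fixes g :: "real \<Rightarrow> 'a::euclidean_space"
  assumes l: "l > 0" and t: "0 \<le> t" and g: "continuous_on {0..t} g"
    and b: "\<And>s. 0 \<le> s \<Longrightarrow> s \<le> t \<Longrightarrow> norm (g s) \<le> C * exp (l * s)" and C: "0 \<le> C"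
  shows "norm (exp (- l * t) *\<^sub>R integral {0..t} g) \<le> C / l"
proof -
  have "((\<lambda>s. C * exp (l * s)) has_integral (C * exp (l * t) / l - C * exp (l * 0) / l)) {0..t}"
    using l by (intro fundamental_theorem_of_calculus t)
      (auto intro!: derivative_eq_intros simp: has_real_derivative_iff_has_vector_derivative[symmetric])
  then have i: "(\<lambda>s. C * exp (l * s)) integrable_on {0..t}"
      "integral {0..t} (\<lambda>s. C * exp (l * s)) = (C * exp (l * t) - C) / l"
    by (auto simp: has_integral_iff diff_divide_distrib)
  have "norm (integral {0..t} g) \<le> integral {0..t} (\<lambda>s. C * exp (l * s))"
    by (rule integral_norm_bound_integral) (use i g b integrable_continuous_interval in auto)
  also have "\<dots> \<le> C / l * exp (l * t)"
    using i l C by (simp add: field_simps)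
  finally have "exp (- l * t) * norm (integral {0..t} g) \<le> exp (- l * t) * (C / l * exp (l * t))"
    by (rule mult_left_mono) simp
  also have "\<dots> = C / l"
    by (simp add: exp_minus)
  finally show ?thesis by simp
qed

lemma continuous_on_integral_from_zero:
  fixes g :: "real \<Rightarrow> 'a::euclidean_space"
  assumes "continuous_on UNIV g"
  shows "continuous_on UNIV (\<lambda>t. integral {0..t} g)"
proof -
  have "continuous_on {-n<..<n} (\<lambda>t. integral {0..t} g)" for n :: real
  proof (cases "n > 0")
    case True
    have "continuous_on {0..n} (\<lambda>t. integral {0..t} g)"
      by (intro indefinite_integral_continuous_1 integrable_continuous_interval
          continuous_on_subset[OF assms]) auto
    \<comment> \<open>For negative times the interval of integration is empty, so replacing t by
      \<open>max 0 t\<close> changes nothing, and continuity on \<open>{0..n}\<close> can be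
      composed.\<close>
    then have "continuous_on {-n<..<n} (\<lambda>t. integral {0..max 0 t} g)"
      by (rule continuous_on_compose2) (use True in \<open>auto intro!: continuous_intros\<close>)
    also have "(\<lambda>t. integral {0..max 0 t} g) = (\<lambda>t. integral {0..t} g)"
      by (auto simp: fun_eq_iff max_def)
    finally show ?thesis .
  qed auto
  then have "continuous_on (\<Union>n\<in>UNIV. {-n<..<n::real}) (\<lambda>t. integral {0..t} g)"
    by (intro continuous_on_open_UN) auto
  moreover have "t \<in> {-(\<bar>t\<bar> + 1)<..<\<bar>t\<bar> + 1}" for t :: real by auto
  then have "(\<Union>n\<in>UNIV. {-n<..<n::real}) = UNIV" by blast
  ultimately show ?thesis by simp
qed

text \<open>
  Picard iteration for \<open>u t = exp (- l t) (x t - x0)\<close>, a contraction of the bounded continuous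
  functions when \<open>l\<close> exceeds the Lipschitz constant. For \<open>t < 0\<close> the integral over \<open>{0..t}\<close> is \<open>0\<close>.
\<close>

lemma lipschitz_ode_forward:
  fixes f :: "'a::euclidean_space \<Rightarrow> 'a"
  assumes "L-lipschitz_on UNIV f"
  obtains x where "x 0 = x0" "\<And>t. t \<ge> 0 \<Longrightarrow> (x has_vector_derivative f (x t)) (at t within {0..})"
proof -
  have L: "L \<ge> 0" "norm (f a - f b) \<le> L * norm (a - b)" for a b
    using assms lipschitz_on_nonneg lipschitz_on_normD by blast+
  define l where "l = L + 1"
  have l: "l > 0" "L < l" using L(1) by (auto simp: l_def)
  define F where "F u s = f (x0 + exp (l * s) *\<^sub>R u s)" for u s
  define T where "T u t = exp (- l * t) *\<^sub>R integral {0..t} (F u)" for u t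
  have contf: "continuous_on UNIV f"
    using assms lipschitz_on_continuous_on by blast
  have contF: "continuous_on UNIV (F u)" if "continuous_on UNIV u" for u
    unfolding F_def
    by (rule continuous_on_compose2[OF contf]) (use that in \<open>auto intro!: continuous_intros\<close>)
  have contT: "continuous_on UNIV (T u)" if "continuous_on UNIV u" for u
    unfolding T_def by (intro continuous_intros continuous_on_integral_from_zero contF that)
  have Tdiff: "norm (T u t - T v t) \<le> L * d / l"
    if uv: "continuous_on UNIV u" "continuous_on UNIV v" "\<And>s. norm (u s - v s) \<le> d" for u v d t
  proof (cases "t \<ge> 0")
    case True
    have d: "d \<ge> 0" using uv(3)[of 0] norm_ge_zero order_trans by blast
    have i: "F u integrable_on {0..t}" "F v integrable_on {0..t}"
      using contF uv by (auto intro!: integrable_continuous_interval intro: continuous_on_subset)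
    have "T u t - T v t = exp (- l * t) *\<^sub>R integral {0..t} (\<lambda>s. F u s - F v s)"
      using i by (simp add: T_def integral_diff scaleR_diff_right)
    also have "norm \<dots> \<le> (L * d) / l"
    proof (rule norm_exp_weighted_integral_le[OF l(1) True])
      show "continuous_on {0..t} (\<lambda>s. F u s - F v s)"
        by (intro continuous_intros continuous_on_subset[OF contF] uv) auto
      fix s :: real
      have "norm (F u s - F v s) \<le> L * norm (exp (l * s) *\<^sub>R (u s - v s))"
        using L(2)[of "x0 + exp (l * s) *\<^sub>R u s" "x0 + exp (l * s) *\<^sub>R v s"]
        by (simp add: F_def scaleR_diff_right del: norm_scaleR)
      also have "\<dots> \<le> L * (exp (l * s) * d)"
        using uv(3) L(1) by (simp add: mult_left_mono)
      finally show "norm (F u s - F v s) \<le> L * d * exp (l * s)" by (simp add: mult_ac)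
    qed (use L d in auto)
    finally show ?thesis .
  next
    case False
    have "d \<ge> 0" using uv(3)[of 0] norm_ge_zero order_trans by blast
    then show ?thesis using False L l by (simp add: T_def)
  qed
  have T0: "norm (T (\<lambda>_. 0) t) \<le> norm (f x0) / l" for t
  proof (cases "t \<ge> 0")
    case True
    show ?thesis
      unfolding T_def
    proof (rule norm_exp_weighted_integral_le[OF l(1) True])
      show "norm (F (\<lambda>_. 0) s) \<le> norm (f x0) * exp (l * s)" if "0 \<le> s" for s
        using that l mult_left_mono[of 1 "exp (l * s)" "norm (f x0)"] by (simp add: F_def)
    qed (auto simp: F_def)
  next
    case False
    then show ?thesis using l by (simp add: T_def)
  qed
  \<comment> \<open>Boundedness of the image follows from the image of the zero function
    (\<open>T0\<close>) and the Lipschitz estimate \<open>Tdiff\<close> against it.\<close>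
  have Tb: "T u \<in> bcontfun" if u: "u \<in> bcontfun" for u
  proof -
    have cu: "continuous_on UNIV u" using u by (simp add: bcontfun_def)
    obtain d where d: "\<And>s. norm (u s) \<le> d"
      using u by (auto simp: bcontfun_def bounded_iff)
    have "norm (T u t) \<le> norm (f x0) / l + L * d / l" for t
      using Tdiff[OF cu continuous_on_const[of _ 0], of d t] d T0[of t] norm_triangle_sub[of "T u t" "T (\<lambda>_. 0) t"]
      by fastforce
    then show ?thesis
      by (intro bcontfun_normI contT cu)
  qed
  \<comment> \<open>Lifted to the complete space of bounded continuous functions, where the Banach
    fixed point theorem applies with factor L / l < 1.\<close>
  define Tc where "Tc u = Bcontfun (T (apply_bcontfun u))" for u
  have Tc: "apply_bcontfun (Tc u) = T (apply_bcontfun u)" for u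
    unfolding Tc_def by (rule Bcontfun_inverse[OF Tb[OF apply_bcontfun]])
  have "dist (Tc u) (Tc v) \<le> L / l * dist u v" for u v
  proof (rule dist_bound)
    show "dist (Tc u t) (Tc v t) \<le> L / l * dist u v" for t
      using Tdiff[of "apply_bcontfun u" "apply_bcontfun v" "dist u v" t] dist_bounded[of u _ v]
      by (simp add: Tc dist_norm)
  qed
  then obtain u where "Tc u = u"
    using banach_fix_type[of "L / l" Tc] L l by auto
  then have u: "T (apply_bcontfun u) = apply_bcontfun u"
    by (metis Tc)
  define x where "x t = x0 + exp (l * t) *\<^sub>R apply_bcontfun u t" for t
  have x: "x t = x0 + integral {0..t} (\<lambda>s. f (x s))" for t
  proof -
    have "apply_bcontfun u t = exp (- l * t) *\<^sub>R integral {0..t} (\<lambda>s. f (x s))"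
      using fun_cong[OF u, of t] by (simp add: T_def F_def[abs_def] x_def)
    then show ?thesis
      unfolding x_def[of t] by (simp flip: exp_add)
  qed
  have cont: "continuous_on UNIV (\<lambda>s. f (x s))"
    using contF[of "apply_bcontfun u"] by (simp add: F_def[abs_def] x_def)
  show ?thesis
  proof
    show "x 0 = x0" using x[of 0] by simp
    fix t :: real assume t: "t \<ge> 0"
    have "((\<lambda>t. x0 + integral {0..t} (\<lambda>s. f (x s))) has_vector_derivative f (x t)) (at t within {0..t+1})"
      by (rule derivative_eq_intros refl integral_has_vector_derivative continuous_on_subset[OF cont])+
        (use t in auto)
    then have "(x has_vector_derivative f (x t)) (at t within {0..t+1})"
      by (simp flip: x)
    moreover have "at t within {0..} = at t within {0..t+1}"
      by (rule at_within_nhd[of t "{t-1<..<t+1}"]) auto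
    ultimately show "(x has_vector_derivative f (x t)) (at t within {0..})"
      by simp
  qed
qed

text \<open>Negative times are covered by a forward solution of the reversed field. The two halves
  agree at 0, and so do their one-sided derivatives, so the glued curve is differentiable
  there.\<close>

lemma lipschitz_ode_global:
  fixes f :: "'a::euclidean_space \<Rightarrow> 'a"
  assumes "L-lipschitz_on UNIV f"
  obtains x where "x 0 = x0" "\<And>t. (x has_vector_derivative f (x t)) (at t)"
proof -
  obtain x where x: "x 0 = x0" "\<And>t. t \<ge> 0 \<Longrightarrow> (x has_vector_derivative f (x t)) (at t within {0..})"
    using lipschitz_ode_forward[OF assms] by metis
  have "L-lipschitz_on UNIV (\<lambda>x. - f x)" using assms by simp
  then obtain y where y: "y 0 = x0"
      "\<And>t. t \<ge> 0 \<Longrightarrow> (y has_vector_derivative - f (y t)) (at t within {0..})"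
    using lipschitz_ode_forward by metis
  define c where "c t = (if t \<in> {0..} then x t else y (- t))" for t
  have "(c has_vector_derivative (if t \<in> {0..} then f (x t) else f (y (- t)))) (at t within UNIV)" for t
    unfolding c_def
  proof (rule has_vector_derivative_If_within_closures[where T = "{..0}"])
    have *: "{0..} \<union> closure {0..} \<inter> closure {..0::real} = {0..}"
        "{..0} \<union> closure {0..} \<inter> closure {..0::real} = {..0}" by auto
    show "(x has_vector_derivative f (x t)) (at t within {0..} \<union> closure {0..} \<inter> closure {..0})"
      if "t \<in> {0..} \<union> closure {0..} \<inter> closure {..0}"
      using that x(2) unfolding * by auto
    show "((\<lambda>t. y (- t)) has_vector_derivative f (y (- t))) (at t within {..0} \<union> closure {0..} \<inter> closure {..0})"
      if "t \<in> {..0} \<union> closure {0..} \<inter> closure {..0}"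
    proof -
      have "uminus ` {..0::real} = {0..}" by (auto simp: image_iff intro: bexI[of _ "- _"])
      then have "(y has_vector_derivative - f (y (- t))) (at (- t) within uminus ` {..0})"
        using y(2)[of "- t"] that unfolding * by auto
      then have "((y \<circ> uminus) has_vector_derivative (- 1) *\<^sub>R (- f (y (- t)))) (at t within {..0})"
        by (intro vector_diff_chain_within) (auto intro!: derivative_eq_intros)
      then show ?thesis unfolding * by (simp add: o_def)
    qed
  qed (use x(1) y(1) in auto)
  moreover have "(if t \<in> {0..} then f (x t) else f (y (- t))) = f (c t)" for t
    by (simp add: c_def)
  ultimately show ?thesis
    using that[of c] x(1) by (simp add: c_def)
qed


section \<open>Conserved quantities and confinement\<close>

definition lip :: "'a::metric_space set \<Rightarrow> ('a \<Rightarrow> 'b::metric_space) \<Rightarrow> bool" where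
  "lip S f \<longleftrightarrow> (\<exists>L. L-lipschitz_on S f)"

lemma lip_bounded:
  assumes "lip S f" "bounded S"
  shows "bounded (f ` S)"
proof -
  obtain L where L: "L-lipschitz_on S f" using assms(1) by (auto simp: lip_def)
  obtain a e where S: "\<And>x. x \<in> S \<Longrightarrow> dist a x \<le> e" using assms(2) by (auto simp: bounded_def)
  show ?thesis
  proof (cases "S = {}")
    case False
    then obtain b where b: "b \<in> S" by blast
    have "dist (f b) (f x) \<le> L * (2 * e)" if "x \<in> S" for x
    proof -
      have "dist b x \<le> 2 * e"
        using S[OF b] S[OF that] dist_triangle[of b x a] by (simp add: dist_commute)
      then have "L * dist b x \<le> L * (2 * e)"
        by (rule mult_left_mono) (use L lipschitz_on_nonneg in auto)
      then show ?thesis using lipschitz_onD[OF L b that] by linarith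
    qed
    then show ?thesis by (auto simp: bounded_def)
  qed auto
qed

lemma lip_const: "lip S (\<lambda>x. c)"
  unfolding lip_def using lipschitz_on_constant by blast

lemma lip_ident: "lip S (\<lambda>x. x)"
  unfolding lip_def using lipschitz_on_id by blast

lemma lip_add: "lip S f \<Longrightarrow> lip S g \<Longrightarrow> lip S (\<lambda>x. f x + g x)"
  for f g :: "'a::metric_space \<Rightarrow> 'b::real_normed_vector"
  unfolding lip_def using lipschitz_on_add by blast

lemma lip_diff: "lip S f \<Longrightarrow> lip S g \<Longrightarrow> lip S (\<lambda>x. f x - g x)"
  for f g :: "'a::metric_space \<Rightarrow> 'b::real_normed_vector"
  unfolding lip_def using lipschitz_on_diff by blast

lemma lip_Pair: "lip S f \<Longrightarrow> lip S g \<Longrightarrow> lip S (\<lambda>x. (f x, g x))"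
  unfolding lip_def using lipschitz_on_Pair by blast

lemma lip_linear:
  assumes "bounded_linear h" "lip S f"
  shows "lip S (\<lambda>x. h (f x))"
proof -
  obtain L where L: "L-lipschitz_on S f" using assms(2) by (auto simp: lip_def)
  obtain B where B: "B-lipschitz_on (f ` S) h"
    using bounded_linear.lipschitz_boundE[OF assms(1)] by metis
  show ?thesis unfolding lip_def using lipschitz_on_compose2[OF L B] by blast
qed

lemma lip_bilinear:
  assumes p: "bounded_bilinear p" and S: "bounded S" and f: "lip S f" and g: "lip S g"
  shows "lip S (\<lambda>x. p (f x) (g x))"
proof -
  obtain L M where L: "L-lipschitz_on S f" and M: "M-lipschitz_on S g"
    using f g by (auto simp: lip_def)
  obtain a where a: "a > 0" "\<And>x. x \<in> S \<Longrightarrow> norm (f x) \<le> a"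
    using lip_bounded[OF f S] by (auto simp: bounded_pos)
  obtain b where b: "b > 0" "\<And>x. x \<in> S \<Longrightarrow> norm (g x) \<le> b"
    using lip_bounded[OF g S] by (auto simp: bounded_pos)
  obtain K where K: "K > 0" "\<And>x y. norm (p x y) \<le> norm x * norm y * K"
    using bounded_bilinear.pos_bounded[OF p] by blast
  note LM = lipschitz_on_nonneg[OF L] lipschitz_on_nonneg[OF M]
  have "(K * (L * b + a * M))-lipschitz_on S (\<lambda>x. p (f x) (g x))"
  proof (rule lipschitz_onI)
    fix x y assume xy: "x \<in> S" "y \<in> S"
    have "p (f x) (g x) - p (f y) (g y) = p (f x - f y) (g x) + p (f y) (g x - g y)"
      by (simp add: bounded_bilinear.diff_left[OF p] bounded_bilinear.diff_right[OF p])
    then have "norm (p (f x) (g x) - p (f y) (g y)) \<le>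
        norm (f x - f y) * norm (g x) * K + norm (f y) * norm (g x - g y) * K"
      using norm_triangle_mono K(2) by metis
    also have "\<dots> \<le> (L * dist x y) * b * K + a * (M * dist x y) * K"
      using lipschitz_onD[OF L xy] lipschitz_onD[OF M xy] a b K(1) xy LM
      by (intro add_mono mult_mono) (auto simp: dist_norm)
    finally show "dist (p (f x) (g x)) (p (f y) (g y)) \<le> K * (L * b + a * M) * dist x y"
      by (simp add: dist_norm algebra_simps)
  qed (use LM K a b in auto)
  then show ?thesis by (auto simp: lip_def)
qed

lemma lip_power:
  fixes f :: "'a::metric_space \<Rightarrow> real"
  assumes "bounded S" "lip S f"
  shows "lip S (\<lambda>x. f x ^ n)"
  by (induction n) (simp_all add: lip_const lip_bilinear[OF bounded_bilinear_mult] assms)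

lemma lip_inverse_norm:
  assumes "\<rho> > 0" "\<And>x. x \<in> S \<Longrightarrow> \<rho> \<le> norm (f x)" "lip S f"
  shows "lip S (\<lambda>x. inverse (norm (f x)))"
proof -
  obtain L where L: "L-lipschitz_on S f" using assms(3) by (auto simp: lip_def)
  have "(L / \<rho>\<^sup>2)-lipschitz_on S (\<lambda>x. inverse (norm (f x)))"
  proof (rule lipschitz_onI)
    fix x y assume xy: "x \<in> S" "y \<in> S"
    have p: "norm (f x) > 0" "norm (f y) > 0" using assms(1,2) xy by force+
    have "inverse (norm (f x)) - inverse (norm (f y)) = (norm (f y) - norm (f x)) / (norm (f x) * norm (f y))"
      using p by (simp add: field_simps)
    then have "\<bar>inverse (norm (f x)) - inverse (norm (f y))\<bar> = \<bar>norm (f y) - norm (f x)\<bar> / (norm (f x) * norm (f y))"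
      using p by (simp add: abs_mult)
    also have "\<dots> \<le> (L * dist x y) / (\<rho> * \<rho>)"
    proof (rule frac_le)
      show "\<bar>norm (f y) - norm (f x)\<bar> \<le> L * dist x y"
        using norm_triangle_ineq3[of "f y" "f x"] lipschitz_onD[OF L xy]
        by (simp add: dist_norm norm_minus_commute)
      show "\<rho> * \<rho> \<le> norm (f x) * norm (f y)"
        using assms(1,2) xy by (intro mult_mono) auto
    qed (use assms(1) lipschitz_on_nonneg[OF L] in auto)
    finally show "dist (inverse (norm (f x))) (inverse (norm (f y))) \<le> L / \<rho>\<^sup>2 * dist x y"
      by (simp add: dist_real_def power2_eq_square)
  qed (use lipschitz_on_nonneg[OF L] in auto)
  then show ?thesis by (auto simp: lip_def)
qed

text \<open>The field is polynomial in the coordinates and in the inverse distance; on a bounded set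
  with distance at least \<open>\<rho>\<close> all these factors are bounded and Lipschitz, hence so
  are their products.\<close>

lemma lip_sat_field:
  assumes "bounded S" "\<rho> > 0" "\<And>z. z \<in> S \<Longrightarrow> \<rho> \<le> norm (fst (snd z))"
  shows "lip S (sat_field I)"
proof -
  note lin = lip_linear[OF bounded_linear_fst] lip_linear[OF bounded_linear_snd]
    lip_linear[OF matrix_vector_mul_bounded_linear] lip_linear[OF bounded_linear_hat]
  note bil = lip_bilinear[OF bounded_bilinear_cross3 assms(1)]
    lip_bilinear[OF bounded_bilinear_matrix_matrix_mult assms(1)]
    lip_bilinear[OF bounded_bilinear_mult assms(1)]
    lip_bilinear[OF bounded_bilinear_scaleR assms(1)]
    lip_bilinear[OF bounded_bilinear_inner assms(1)]
  have R: "lip S (\<lambda>z. fst (snd z))" and m: "lip S (\<lambda>z. fst (snd (snd z)))"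
      and P: "lip S (\<lambda>z. snd (snd (snd z)))" and B: "lip S (\<lambda>z. fst z)"
    by (intro lin lip_ident)+
  have q: "lip S (\<lambda>z. inverse (norm (fst (snd z))) ^ n)" for n
    by (intro lip_power lip_inverse_norm[OF assms(2)] assms R)
  have W: "lip S (\<lambda>z. matrix_inv I *v (fst (snd (snd z)) - cross3 (fst (snd z)) (snd (snd (snd z)))))"
    by (intro lin lip_diff bil R m P)
  have V: "lip S (\<lambda>z. gradV I (fst (snd z)))"
    unfolding gradV_def Let_def by (intro lip_add lip_diff bil q R lin(3) lip_const)
  have e: "sat_field I = (\<lambda>z. let W = matrix_inv I *v (fst (snd (snd z)) - cross3 (fst (snd z)) (snd (snd (snd z)))) in
    (fst z ** hat W, snd (snd (snd z)) - cross3 W (fst (snd z)), cross3 (fst (snd (snd z))) W,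
     cross3 (snd (snd (snd z))) W - gradV I (fst (snd z))))"
    by (auto simp: fun_eq_iff sat_field_def angvel_def)
  show ?thesis
    unfolding e Let_def by (intro lip_Pair lip_diff bil lin(4) W V B R m P)
qed

text \<open>The nearest-point projection onto a convex set is 1-Lipschitz, so precomposing with it
  extends the field from \<open>K\<close> to a globally Lipschitz one that agrees with it on
  \<open>K\<close>.\<close>

lemma cutoff_ode:
  fixes f :: "'a::euclidean_space \<Rightarrow> 'a"
  assumes "lip K f" "compact K" "convex K" "K \<noteq> {}"
  obtains c where "c 0 = z" "\<And>t. (c has_vector_derivative f (closest_point K (c t))) (at t)"
proof -
  obtain L where L: "L-lipschitz_on K f" using assms(1) by (auto simp: lip_def)
  have K: "closed K" using assms(2) by (rule compact_imp_closed)
  have "1-lipschitz_on UNIV (closest_point K)"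
    using closest_point_lipschitz[OF assms(3) K assms(4)] by (auto intro: lipschitz_onI)
  moreover have "L-lipschitz_on (closest_point K ` UNIV) f"
    by (rule lipschitz_on_subset[OF L]) (use closest_point_in_set[OF K assms(4)] in auto)
  ultimately have "(L * 1)-lipschitz_on UNIV (\<lambda>x. f (closest_point K x))"
    by (rule lipschitz_on_compose2)
  from lipschitz_ode_global[OF this] that show ?thesis by metis
qed

text \<open>First exit time argument. At the infimum \<open>\<tau>\<close> of the times outside
  \<open>K\<close> the curve has been in the closed set \<open>K\<close> throughout, so
  \<open>step\<close> puts it into the open set \<open>U\<close>, where it remains for a while
  longer; but exit times accumulate at \<open>\<tau>\<close> or include it.\<close>

lemma confined_forward:
  fixes c :: "real \<Rightarrow> 'a::metric_space"
  assumes c: "continuous_on {0..} c" and K: "closed K" and U: "open U" "U \<subseteq> K" and "c 0 \<in> K"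
    and step: "\<And>T. T \<ge> 0 \<Longrightarrow> \<forall>s\<in>{0..T}. c s \<in> K \<Longrightarrow> c T \<in> U"
    and "t \<ge> 0"
  shows "c t \<in> K"
proof (rule ccontr)
  assume t: "c t \<notin> K"
  define X where "X = {s. 0 \<le> s \<and> c s \<notin> K}"
  define \<tau> where "\<tau> = Inf X"
  have X: "X \<noteq> {}" "bdd_below X" using t \<open>t \<ge> 0\<close> by (auto simp: X_def intro: bdd_belowI[of _ 0])
  have \<tau>0: "\<tau> \<ge> 0" unfolding \<tau>_def by (rule cInf_greatest[OF X(1)]) (auto simp: X_def)
  have before: "c s \<in> K" if "0 \<le> s" "s < \<tau>" for s
    using cInf_lower[OF _ X(2), of s] that by (auto simp: X_def \<tau>_def)
  have "c \<tau> \<in> K"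
  proof (cases "\<tau> = 0")
    case False
    have "closed ({0..\<tau>} \<inter> c -` K)"
      by (intro continuous_closed_preimage continuous_on_subset[OF c] K) auto
    then have "closure {0..<\<tau>} \<subseteq> {0..\<tau>} \<inter> c -` K"
      by (rule closure_minimal[rotated]) (use before in auto)
    then show ?thesis using False \<tau>0 by auto
  qed (use \<open>c 0 \<in> K\<close> in simp)
  then have "\<forall>s\<in>{0..\<tau>}. c s \<in> K" using before by (metis atLeastAtMost_iff less_eq_real_def)
  from step[OF \<tau>0 this] have "c \<tau> \<in> U" .
  moreover have "continuous (at \<tau> within {0..}) c"
    using c \<tau>0 by (auto simp: continuous_on_eq_continuous_within)
  ultimately have "eventually (\<lambda>s. c s \<in> U) (at \<tau> within {0..})"
    using U(1) by (auto simp: continuous_within topological_tendstoD)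
  then obtain d where d: "d > 0" "\<And>s. s \<ge> 0 \<Longrightarrow> s \<noteq> \<tau> \<Longrightarrow> dist s \<tau> < d \<Longrightarrow> c s \<in> U"
    unfolding eventually_at by auto
  have "c s \<in> K" if "0 \<le> s" "s < \<tau> + d" for s
    using before[of s] d(2)[of s] \<open>c \<tau> \<in> U\<close> U(2) that by (cases s \<tau> rule: linorder_cases) (auto simp: dist_real_def)
  moreover obtain s where "s \<in> X" "s < \<tau> + d"
    using cInf_lessD[OF X(1), of "\<tau> + d"] d(1) by (auto simp: \<tau>_def)
  ultimately show False by (auto simp: X_def)
qed

section \<open>First integrals along curves in the ambient space\<close>

lemma first_integral:
  assumes "T \<ge> 0" and "\<And>s. s \<in> {0..T} \<Longrightarrow> (c has_vector_derivative \<kappa> *\<^sub>R f (c s)) (at s)"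
    and "\<And>s. s \<in> {0..T} \<Longrightarrow> (Q has_derivative DQ (c s)) (at (c s)) \<and> DQ (c s) (f (c s)) = 0"
  shows "Q (c T) = Q (c (0::real))"
proof -
  have "((\<lambda>s. Q (c s)) has_vector_derivative 0) (at s within {0..T})" if s: "s \<in> {0..T}" for s
  proof -
    interpret DQ: bounded_linear "DQ (c s)" using assms(3)[OF s] has_derivative_bounded_linear by blast
    have "((\<lambda>s. Q (c s)) has_derivative (\<lambda>h. DQ (c s) (h *\<^sub>R (\<kappa> *\<^sub>R f (c s))))) (at s)"
      using has_derivative_compose[of c _ s UNIV Q "DQ (c s)"] assms(2,3)[OF s]
      by (auto simp: has_vector_derivative_def)
    then have "((\<lambda>s. Q (c s)) has_derivative (\<lambda>h. 0)) (at s)"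
      using assms(3)[OF s] by (simp add: DQ.scaleR)
    then show ?thesis
      by (simp add: has_vector_derivative_def has_derivative_at_withinI)
  qed
  then obtain a where "\<And>s. s \<in> {0..T} \<Longrightarrow> Q (c s) = a"
    using has_vector_derivative_zero_constant[of "{0..T}" "\<lambda>s. Q (c s)"] by (metis convex_real_interval(5))
  then show ?thesis using assms(1) by simp
qed

text \<open>Energy, the Casimir m.m, and the spatial angular momentum, bundled into one map. The
  component \<open>B ** transpose B\<close> certifies that an ambient solution starting at a
  rotation stays orthogonal.\<close>

definition integrals :: "real^3^3 \<Rightarrow> phase \<Rightarrow> real \<times> real \<times> (real^3^3) \<times> (real^3)" where
  "integrals I = (\<lambda>(B, R, m, P). (energy I (R, m, P), m \<bullet> m, B ** transpose B, B *v m))"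

lemma bounded_linear_transpose: "bounded_linear (transpose :: real^3^3 \<Rightarrow> real^3^3)"
  unfolding linear_conv_bounded_linear[symmetric]
  by (rule linearI) (simp_all add: transpose_def vec_eq_iff)

lemma integrals_has_derivative:
  assumes I: "transpose I = I" "invertible I" and R: "R \<noteq> 0"
  shows "(integrals I has_derivative (\<lambda>(b, r, a, p). (grad_energy I (R, m, P) \<bullet> (r, a, p), 2 * (m \<bullet> a),
    b ** transpose B + B ** transpose b, b *v m + B *v a))) (at (B, R, m, P))"
proof -
  have e: "integrals I = (\<lambda>z. (energy I (snd z), fst (snd (snd z)) \<bullet> fst (snd (snd z)),
      fst z ** transpose (fst z), fst z *v fst (snd (snd z))))"
    by (auto simp: integrals_def fun_eq_iff)
  have E: "((\<lambda>z. energy I (snd z)) has_derivative (\<lambda>h. grad_energy I (R, m, P) \<bullet> snd h)) (at (B, R, m, P))"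
    using has_derivative_compose[of snd snd "(B, R, m, P)" UNIV "energy I"] energy_has_derivative[OF I, of "(R, m, P)"] R
    by (simp add: bounded_linear_imp_has_derivative bounded_linear_snd)
  show ?thesis
    unfolding e
    apply (rule has_derivative_eq_rhs)
     apply (rule E derivative_eq_intros bounded_linear.has_derivative[OF bounded_linear_transpose] refl)+
    apply (auto simp: fun_eq_iff inner_commute)
    done
qed

lemma integrals_sat_field:
  "(\<lambda>(b, r, a, p). (grad_energy I (R, m, P) \<bullet> (r, a, p), 2 * (m \<bullet> a),
    b ** transpose B + B ** transpose b, b *v m + B *v a)) (sat_field I (B, R, m, P)) = 0"
proof -
  define W where "W = angvel I (R, m, P)"
  have 1: "B ** hat W ** transpose B + B ** transpose (B ** hat W) = 0"
    by (simp add: matrix_transpose_mul transpose_hat matrix_mul_assoc[symmetric] mult_mat_linear)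
  have 2: "(B ** hat W) *v m + B *v cross3 m W = 0"
    by (simp add: hat_mult_vec cross_skew[of m W] flip: matrix_vector_mul_assoc)
      (simp add: mult_vec_linear flip: matrix_vector_right_distrib)
  show ?thesis
    using 1 2
    by (simp add: sat_field_def grad_energy_def dot_cross_self flip: W_def zero_prod_def)
      (simp add: zero_prod_def inner_diff_left inner_diff_right inner_commute)
qed


section \<open>The energy-Casimir method\<close>

text \<open>The rows are unit vectors, so the norm is sqrt 3. This is the origin of the radius 2 in
  \<open>cball 0 2\<close> below: orthogonal matrices stay in its interior.\<close>

lemma norm_orthogonal_lt_2:
  fixes B :: "real^3^3"
  assumes "B ** transpose B = mat 1"
  shows "norm B < 2"
proof -
  have "B $ i \<bullet> B $ i = (B ** transpose B) $ i $ i" for i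
    by (simp add: matrix_matrix_mult_def transpose_def inner_vec_def)
  then have "B \<bullet> B = 3"
    unfolding inner_vec_def[of B B] by (simp add: assms mat_def)
  then have "norm B = sqrt 3"
    by (simp add: norm_eq_sqrt_inner)
  then show ?thesis by (simp add: real_less_lsqrt)
qed

lemma continuous_on_det3:
  fixes f :: "'a::topological_space \<Rightarrow> real^3^3"
  assumes "continuous_on S f"
  shows "continuous_on S (\<lambda>x. det (f x))"
  unfolding det_3 by (intro continuous_intros assms)

lemma compact_rotation_matrices: "compact {B :: real^3^3. rotation_matrix B}"
proof (rule compact_eq_bounded_closed[THEN iffD2], rule conjI)
  have 1: "{B :: real^3^3. rotation_matrix B} = {B. B ** transpose B = mat 1} \<inter> {B. det B = 1}"
    by (auto simp: rotation_matrix_def orthogonal_matrix_def matrix_left_right_inverse)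
  show "bounded {B :: real^3^3. rotation_matrix B}"
    unfolding 1 bounded_iff using norm_orthogonal_lt_2 less_imp_le by blast
  have "continuous_on UNIV (\<lambda>B :: real^3^3. B ** transpose B)"
    by (intro bounded_bilinear.continuous_on[OF bounded_bilinear_matrix_matrix_mult]
        linear_continuous_on bounded_linear_transpose continuous_on_id)
  then show "closed {B :: real^3^3. rotation_matrix B}"
    unfolding 1 by (intro closed_Int closed_Collect_eq continuous_on_det3 continuous_on_id continuous_on_const)
qed

text \<open>Conservation keeps the curve off the boundary of \<open>K\<close>: in the reduced
  variables by \<open>trap\<close>, in the matrix factor by orthogonality. The equation is assumed
  only while the curve is in \<open>K\<close>, so that the lemma serves both the cut-off solution
  and genuine evolutions.\<close>

lemma confined_by_integrals:
  assumes I: "transpose I = I" "invertible I"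
    and K: "K = cball 0 2 \<times> cball y0 \<epsilon>" and nz: "\<And>y. y \<in> cball y0 \<epsilon> \<Longrightarrow> fst y \<noteq> 0"
    and trap: "\<And>B y. (B, y) \<in> K \<Longrightarrow> integrals I (B, y) = integrals I (c 0) \<Longrightarrow> y \<in> ball y0 \<epsilon>"
    and c0: "c 0 \<in> K" "fst (c 0) ** transpose (fst (c 0)) = mat 1"
    and c: "continuous_on UNIV c"
    and c': "\<And>t. c t \<in> K \<Longrightarrow> (c has_vector_derivative sat_field I (c t)) (at t)"
  shows "c t \<in> K \<and> integrals I (c t) = integrals I (c 0)"
proof -
  have const: "integrals I (e T) = integrals I (e 0)"
    if "T \<ge> 0" "\<forall>s\<in>{0..T}. e s \<in> K"
      "\<And>t. e t \<in> K \<Longrightarrow> (e has_vector_derivative \<kappa> *\<^sub>R sat_field I (e t)) (at t)" for \<kappa> T and e :: "real \<Rightarrow> phase"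
  proof (rule first_integral[where f = "sat_field I" and \<kappa> = \<kappa> and DQ = "\<lambda>(B, R, m, P) (b, r, a, p).
      (grad_energy I (R, m, P) \<bullet> (r, a, p), 2 * (m \<bullet> a), b ** transpose B + B ** transpose b, b *v m + B *v a)"])
    fix s assume s: "s \<in> {0..T}"
    obtain B R m P where e: "e s = (B, R, m, P)" by (cases "e s")
    have R: "R \<noteq> 0" using nz[of "(R, m, P)"] bspec[OF that(2) s] by (auto simp: K e)
    show "(integrals I has_derivative (case e s of (B, R, m, P) \<Rightarrow> \<lambda>(b, r, a, p).
        (grad_energy I (R, m, P) \<bullet> (r, a, p), 2 * (m \<bullet> a), b ** transpose B + B ** transpose b, b *v m + B *v a)))
        (at (e s)) \<and> (case e s of (B, R, m, P) \<Rightarrow> \<lambda>(b, r, a, p).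
        (grad_energy I (R, m, P) \<bullet> (r, a, p), 2 * (m \<bullet> a), b ** transpose B + B ** transpose b, b *v m + B *v a))
        (sat_field I (e s)) = 0"
      using integrals_has_derivative[OF I R, of m P B] integrals_sat_field[of I R m P B] by (simp add: e)
  qed (use that in auto)
  have fwd: "e t \<in> K \<and> integrals I (e t) = integrals I (c 0)"
    if "t \<ge> 0" "e 0 = c 0" "continuous_on UNIV e"
      and e': "\<And>t. e t \<in> K \<Longrightarrow> (e has_vector_derivative \<kappa> *\<^sub>R sat_field I (e t)) (at t)" for \<kappa> e t
  proof -
    have "e T \<in> K" if "T \<ge> 0" for T
    proof (rule confined_forward[where c = e and U = "ball 0 2 \<times> ball y0 \<epsilon>"])
      show "continuous_on {0..} e" using \<open>continuous_on UNIV e\<close> continuous_on_subset by blast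
      show "closed K" "ball 0 2 \<times> ball y0 \<epsilon> \<subseteq> K" "open (ball (0 :: real^3^3) 2 \<times> ball y0 \<epsilon>)"
        by (auto simp: K closed_Times open_Times)
      show "e 0 \<in> K" using c0 \<open>e 0 = c 0\<close> by simp
      fix S :: real assume S: "S \<ge> 0" "\<forall>s\<in>{0..S}. e s \<in> K"
      have i: "integrals I (e S) = integrals I (c 0)"
        using const[OF S e'] \<open>e 0 = c 0\<close> by simp
      obtain B y where e: "e S = (B, y)" by (cases "e S")
      have "y \<in> ball y0 \<epsilon>" using trap[of B y] i S e by force
      moreover have "B ** transpose B = mat 1"
        using i c0(2) by (simp add: e integrals_def split: prod.splits)
      then have "B \<in> ball 0 2" using norm_orthogonal_lt_2 by auto
      ultimately show "e S \<in> ball 0 2 \<times> ball y0 \<epsilon>" by (simp add: e)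
    qed (rule that)
    then have "\<forall>s\<in>{0..t}. e s \<in> K" by simp
    then show ?thesis using const[OF \<open>t \<ge> 0\<close> _ e'] \<open>e 0 = c 0\<close> \<open>t \<ge> 0\<close> by auto
  qed
  show ?thesis
  proof (cases "t \<ge> 0")
    case True
    show ?thesis using fwd[OF True refl c, of 1] c' by simp
  next
    case False
    \<comment> \<open>Negative times are forward times of the reversed curve; this is why
      \<open>const\<close> and \<open>fwd\<close> carry the factor \<open>\<kappa>\<close>, here
      -1.\<close>
    have "((\<lambda>s. c (- s)) has_vector_derivative (- 1) *\<^sub>R sat_field I (c (- s))) (at s)" if "c (- s) \<in> K" for s
    proof -
      have "((c \<circ> uminus) has_vector_derivative (- 1) *\<^sub>R sat_field I (c (- s))) (at s)"
        by (rule vector_diff_chain_at) (use c'[OF that] in \<open>auto intro!: derivative_eq_intros\<close>)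
      then show ?thesis by (simp add: o_def)
    qed
    moreover have "continuous_on UNIV (\<lambda>s. c (- s))"
      by (rule continuous_on_compose2[OF c]) (auto intro!: continuous_intros)
    ultimately show ?thesis
      using fwd[of "- t" "\<lambda>s. c (- s)" "- 1"] False by simp
  qed
qed

text \<open>The cut-off solution never leaves \<open>K\<close>, hence never feels the cutoff and
  solves the true equation. What remains is that it stays in the phase space.\<close>

lemma confined_evolution_exists:
  assumes I: "transpose I = I" "invertible I"
    and K: "K = cball 0 2 \<times> cball y0 \<epsilon>" and \<epsilon>: "\<epsilon> > 0" "\<epsilon> < norm (fst y0)"
    and trap: "\<And>B y. (B, y) \<in> K \<Longrightarrow> integrals I (B, y) = integrals I z \<Longrightarrow> y \<in> ball y0 \<epsilon>"
    and z: "z \<in> K" "z \<in> phase_space"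
  shows "\<exists>c. evolution (H2 I) z c"
proof -
  have low: "norm (fst y0) - \<epsilon> \<le> norm (fst y)" if "y \<in> cball y0 \<epsilon>" for y
    using that norm_triangle_ineq2[of "fst y0" "fst y"] dist_fst_le[of y0 y] by (simp add: dist_norm)
  then have nz: "fst y \<noteq> 0" if "y \<in> cball y0 \<epsilon>" for y
    using low[OF that] \<epsilon> by auto
  have lip: "lip K (sat_field I)"
    by (rule lip_sat_field[where \<rho> = "norm (fst y0) - \<epsilon>"])
      (use \<epsilon> low in \<open>auto simp: K bounded_Times\<close>)
  obtain c where c: "c 0 = z" "\<And>t. (c has_vector_derivative sat_field I (closest_point K (c t))) (at t)"
    by (rule cutoff_ode[OF lip, of z]) (use z in \<open>auto simp: K compact_Times convex_Times\<close>)
  have contc: "continuous_on UNIV c"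
    by (rule continuous_at_imp_continuous_on) (use has_vector_derivative_continuous[OF c(2)] in blast)
  have c': "(c has_vector_derivative sat_field I (c t)) (at t)" if "c t \<in> K" for t
    using c(2)[of t] closest_point_self[OF that] by simp
  obtain B y where zB: "z = (B, y)" by (cases z)
  have B: "orthogonal_matrix B" "det B = 1"
    using z zB by (auto simp: phase_space_def rotation_matrix_def)
  have in_K: "c t \<in> K \<and> integrals I (c t) = integrals I (c 0)" for t
    by (rule confined_by_integrals[OF I K nz _ _ _ contc c'])
      (use trap z zB B c(1) in \<open>auto simp: orthogonal_matrix_def\<close>)
  have orth: "fst (c t) ** transpose (fst (c t)) = mat 1" for t
    using conjunct2[OF in_K[of t]] B
    by (simp add: c(1) zB integrals_def orthogonal_matrix_def split: prod.splits)
  then have orth: "orthogonal_matrix (fst (c t))" for t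
    by (simp add: orthogonal_matrix_def matrix_left_right_inverse)
  \<comment> \<open>Orthogonality allows determinant 1 or -1; by continuity in time it cannot jump
    away from its initial value 1.\<close>
  have "(\<lambda>t. det (fst (c t))) constant_on UNIV"
  proof (rule continuous_finite_range_constant)
    show "continuous_on UNIV (\<lambda>t. det (fst (c t)))"
      by (intro continuous_on_det3 continuous_intros contc)
    have "range (\<lambda>t. det (fst (c t))) \<subseteq> {1, -1}"
      using det_orthogonal_matrix[OF orth] by auto
    then show "finite (range (\<lambda>t. det (fst (c t))))" by (rule finite_subset) simp
  qed (rule connected_UNIV)
  then have det: "det (fst (c t)) = 1" for t
    using B c(1) zB by (metis (mono_tags, lifting) UNIV_I constant_on_def fst_conv)
  have ph: "c t \<in> phase_space" for t
  proof -
    obtain B' R' m' P' where ct: "c t = (B', R', m', P')" by (cases "c t")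
    have "(R', m', P') \<in> cball y0 \<epsilon>" using in_K[of t] by (simp add: K ct)
    then show ?thesis
      using nz[of "(R', m', P')"] det[of t] orth[of t] by (simp add: ct phase_space_def rotation_matrix_def)
  qed
  have "(c has_vector_derivative ham_field (H2 I) (c t)) (at t)" for t
    using c'[of t] in_K[of t] nz ham_field_H2[OF I, of "c t"] by (auto simp: K mem_Times_iff)
  then show ?thesis
    using c(1) ph by (auto simp: evolution_def)
qed

text \<open>Compactness of the rotation group: \<open>h\<close> measures the defect of the reduced
  variables and of the angular momentum, and vanishes on rotations only at points of the orbit. On
  the compact set \<open>D\<close> outside the neighborhood it therefore has a positive lower
  bound.\<close>

lemma near_orbit:
  assumes W: "openin (top_of_set phase_space) W"
    and orbit: "\<And>M. rotation_matrix M \<Longrightarrow> M *v m0 = m0 \<Longrightarrow> (M, R0, m0, P0) \<in> W"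
  obtains \<delta> where "\<delta> > 0" "\<And>B y. (B, y) \<in> phase_space \<Longrightarrow> dist y (R0, m0, P0) < \<delta> \<Longrightarrow>
    dist (B *v fst (snd y)) m0 < \<delta> \<Longrightarrow> (B, y) \<in> W"
proof -
  obtain W' where W': "open W'" "W = phase_space \<inter> W'"
    using W openin_open by metis
  define D where "D = ({B. rotation_matrix B} \<times> cball (R0, m0, P0) 1) - W'"
  define h where "h z = dist (snd z) (R0, m0, P0) + dist (fst z *v fst (snd (snd z))) m0" for z :: phase
  have D: "compact D"
    unfolding D_def using W'(1)
    by (intro compact_diff compact_Times compact_rotation_matrices) auto
  have cont: "continuous_on D h"
    unfolding h_def
    by (intro continuous_intros bounded_bilinear.continuous_on[OF bounded_bilinear_matrix_vector_mult])
  have pos: "h z > 0" if "z \<in> D" for z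
  proof (rule ccontr)
    assume "\<not> h z > 0"
    then have "h z \<le> 0" by simp
    then have "snd z = (R0, m0, P0)" "fst z *v fst (snd (snd z)) = m0"
      unfolding h_def by (smt (verit) zero_le_dist dist_eq_0_iff)+
    then have "z \<in> W" using orbit[of "fst z"] that by (cases z) (auto simp: D_def)
    then show False using that W'(2) by (auto simp: D_def)
  qed
  obtain e where e: "e > 0" "\<And>z. z \<in> D \<Longrightarrow> e \<le> h z"
  proof (cases "D = {}")
    case False
    then obtain z where "z \<in> D" "\<forall>z'\<in>D. h z \<le> h z'"
      using continuous_attains_inf[OF D _ cont] by blast
    then show ?thesis using that[of "h z"] pos by blast
  qed (use that[of 1] in auto)
  show ?thesis
  proof
    \<comment> \<open>The 1 keeps the point in the ball used to define \<open>D\<close>;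
      \<open>e / 2\<close> bounds each of the two summands of \<open>h\<close>.\<close>
    show "min 1 (e / 2) > 0" using e by simp
    fix B y assume *: "(B, y) \<in> phase_space" "dist y (R0, m0, P0) < min 1 (e / 2)"
      "dist (B *v fst (snd y)) m0 < min 1 (e / 2)"
    have "h (B, y) < e" using *(2,3) by (simp add: h_def)
    then have "(B, y) \<notin> D" using e(2)[of "(B, y)"] by auto
    then show "(B, y) \<in> W"
      using *(1,2) W'(2) by (auto simp: D_def phase_space_def dist_commute)
  qed
qed

text \<open>
  The energy-Casimir method: only the part of the orbit on which \<open>\<Gamma>\<close> acts trivially is needed,
  and the spatial angular momentum, being conserved, keeps \<open>B\<close> near the stabiliser of \<open>m0\<close>.
\<close>

lemma Gmu_stableI:
  fixes \<phi> :: "real \<times> real \<Rightarrow> real"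
  assumes I: "transpose I = I" "invertible I" and R0: "R0 \<noteq> 0"
    and \<phi>: "continuous_on UNIV \<phi>" and "\<epsilon>0 > 0"
    and min: "\<And>R m P. (R, m, P) \<in> cball (R0, m0, P0) \<epsilon>0 \<Longrightarrow> (R, m, P) \<noteq> (R0, m0, P0) \<Longrightarrow>
      \<phi> (energy I (R0, m0, P0), m0 \<bullet> m0) < \<phi> (energy I (R, m, P), m \<bullet> m)"
  shows "Gmu_stable I (mat 1, R0, m0, P0)"
  unfolding Gmu_stable_def Let_def
proof (intro allI impI, elim conjE)
  let ?y0 = "(R0, m0, P0)" and ?p = "(mat 1 :: real^3^3, R0, m0, P0)"
  fix U assume U: "nbhd ((\<lambda>g. act g ?p) ` Gasym_stab (momentum ?p)) U"
  obtain W where W: "openin (top_of_set phase_space) W" "(\<lambda>g. act g ?p) ` Gasym_stab (momentum ?p) \<subseteq> W" "W \<subseteq> U"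
    using U by (auto simp: nbhd_def)
  have one: "mat 1 \<in> Gam"
    unfolding Gam_def diag3_one[symmetric] by blast
  have orbit: "(M, R0, m0, P0) \<in> W" if "rotation_matrix M" "M *v m0 = m0" for M
  proof -
    have "(M, mat 1) \<in> Gasym_stab (momentum ?p)"
      using that one by (simp add: Gasym_stab_def Gasym_def)
    then have "act (M, mat 1) ?p \<in> W" using W(2) by blast
    then show ?thesis by (simp add: transpose_mat)
  qed
  obtain \<delta> where \<delta>: "\<delta> > 0" "\<And>B y. (B, y) \<in> phase_space \<Longrightarrow> dist y ?y0 < \<delta> \<Longrightarrow>
    dist (B *v fst (snd y)) m0 < \<delta> \<Longrightarrow> (B, y) \<in> W"
    using near_orbit[OF W(1) orbit] by metis
  \<comment> \<open>Within \<open>\<epsilon>0\<close> for the strict minimum, below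
    \<open>\<delta>\<close> for \<open>near_orbit\<close>, and below \<open>norm R0\<close> so that
    the closed ball contains no collision.\<close>
  define \<epsilon> where "\<epsilon> = min (min \<epsilon>0 (\<delta> / 2)) (norm R0 / 2)"
  have \<epsilon>: "\<epsilon> > 0" "\<epsilon> \<le> \<epsilon>0" "\<epsilon> < \<delta>" "\<epsilon> < norm R0"
    using \<delta>(1) \<open>\<epsilon>0 > 0\<close> zero_less_norm_iff[THEN iffD2, OF R0] unfolding \<epsilon>_def by linarith+
  have nz: "fst y \<noteq> 0" if "y \<in> cball ?y0 \<epsilon>" for y
    using that norm_triangle_ineq2[of R0 "fst y"] dist_fst_le[of ?y0 y] \<epsilon> by (auto simp: dist_norm)
  define F where "F y = \<phi> (energy I y, fst (snd y) \<bullet> fst (snd y))" for y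
  have contF: "continuous_on (cball ?y0 \<epsilon>) F"
  proof -
    have "continuous_on (cball ?y0 \<epsilon>) (energy I)"
      using energy_has_derivative[OF I nz] has_derivative_continuous
      by (blast intro: continuous_at_imp_continuous_on)
    then show ?thesis
      unfolding F_def by (intro continuous_on_compose2[OF \<phi>] continuous_intros) auto
  qed
  have "\<exists>y\<in>sphere ?y0 \<epsilon>. \<forall>y'\<in>sphere ?y0 \<epsilon>. F y \<le> F y'"
    using \<epsilon>(1) by (intro continuous_attains_inf continuous_on_subset[OF contF]) auto
  then obtain d where d: "F ?y0 < d" "\<And>y. y \<in> sphere ?y0 \<epsilon> \<Longrightarrow> d \<le> F y"
  proof (elim bexE)
    fix y assume y: "y \<in> sphere ?y0 \<epsilon>" "\<forall>y'\<in>sphere ?y0 \<epsilon>. F y \<le> F y'"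
    obtain R m P where "y = (R, m, P)" by (cases y)
    moreover have "y \<noteq> ?y0" using y(1) \<epsilon> by auto
    ultimately have "F ?y0 < F y" using min[of R m P] y(1) \<epsilon> by (simp add: F_def)
    then show ?thesis using that[of "F y"] y by blast
  qed
  \<comment> \<open>The sublevel condition on \<open>F\<close> confines the reduced variables; the
    last condition bounds the conserved spatial angular momentum and thereby controls the
    attitude.\<close>
  define N where "N = {(B, y). (B, y) \<in> phase_space \<and> y \<in> ball ?y0 \<epsilon> \<and> F y < d \<and> dist (B *v fst (snd y)) m0 < \<delta>}"
  have openN: "openin (top_of_set phase_space) N"
  proof -
    have "continuous_on (ball ?y0 \<epsilon>) F"
      using contF continuous_on_subset ball_subset_cball by blast
    then have "open (ball ?y0 \<epsilon> \<inter> F -` {..<d})"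
      by (intro continuous_open_preimage) auto
    then have "open ((UNIV :: (real^3^3) set) \<times> (ball ?y0 \<epsilon> \<inter> F -` {..<d}))"
      by (intro open_Times) auto
    moreover have "open {z :: phase. dist (fst z *v fst (snd (snd z))) m0 < \<delta>}"
      by (intro open_Collect_less continuous_intros
          bounded_bilinear.continuous_on[OF bounded_bilinear_matrix_vector_mult])
    moreover have "N = phase_space \<inter> ((UNIV \<times> (ball ?y0 \<epsilon> \<inter> F -` {..<d})) \<inter>
        {z. dist (fst z *v fst (snd (snd z))) m0 < \<delta>})"
      by (auto simp: N_def)
    ultimately show ?thesis by (auto intro!: openin_open_Int)
  qed
  have N: "nbhd {?p} N"
    unfolding nbhd_def using openN \<delta> \<epsilon> d(1) R0
    by (auto simp: N_def phase_space_def rotation_matrix_def orthogonal_matrix_id intro!: exI[of _ N])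
  have main: "(\<exists>c. evolution (H2 I) z c) \<and> (\<forall>c. evolution (H2 I) z c \<longrightarrow> (\<forall>t. c t \<in> U))" if z: "z \<in> N" for z
  proof -
    define K where "K = cball (0 :: real^3^3) 2 \<times> cball ?y0 \<epsilon>"
    obtain B y where zB: "z = (B, y)" by (cases z)
    have zp: "z \<in> phase_space" and y: "y \<in> ball ?y0 \<epsilon>" "F y < d" "dist (B *v fst (snd y)) m0 < \<delta>"
      using z zB by (auto simp: N_def)
    have BB: "B ** transpose B = mat 1"
      using zp zB by (auto simp: phase_space_def rotation_matrix_def orthogonal_matrix_def)
    have zK: "z \<in> K" using zB y norm_orthogonal_lt_2[OF BB] by (auto simp: K_def)
    have F: "F y' = F y" "B' *v fst (snd y') = B *v fst (snd y)" if "integrals I (B', y') = integrals I z" for B' y'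
      using that by (cases y'; cases y; simp add: zB integrals_def F_def)+
    have trap: "y' \<in> ball ?y0 \<epsilon>" if "(B', y') \<in> K" "integrals I (B', y') = integrals I z" for B' y'
    proof (rule ccontr)
      assume "y' \<notin> ball ?y0 \<epsilon>"
      then have "y' \<in> sphere ?y0 \<epsilon>" using that(1) by (auto simp: K_def)
      then show False using d(2)[of y'] F(1)[OF that(2)] y(2) by simp
    qed
    have "c t \<in> U" if c: "evolution (H2 I) z c" for c t
    proof -
      have c0: "c 0 = z" and ph: "\<And>t. c t \<in> phase_space"
        and c': "\<And>t. (c has_vector_derivative ham_field (H2 I) (c t)) (at t)"
        using c by (auto simp: evolution_def)
      have c'': "(c has_vector_derivative sat_field I (c t)) (at t)" for t
        using c'[of t] ham_field_H2[OF I, of "c t"] ph[of t] by (auto simp: phase_space_def)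
      have contc: "continuous_on UNIV c"
        by (rule continuous_at_imp_continuous_on) (use has_vector_derivative_continuous[OF c'] in blast)
      have "c t \<in> K \<and> integrals I (c t) = integrals I (c 0)"
        by (rule confined_by_integrals[OF I K_def nz _ _ _ contc c''])
          (use trap zK BB c0 zB in auto)
      then have *: "c t \<in> K" "integrals I (c t) = integrals I z" using c0 by auto
      obtain B' y' where ct: "c t = (B', y')" by (cases "c t")
      have "(B', y') \<in> W"
        by (rule \<delta>(2)) (use ph[of t] trap[of B' y'] F(2)[of B' y'] y(3) \<epsilon>(3) * ct in \<open>auto simp: dist_commute\<close>)
      then show ?thesis using W(3) ct by auto
    qed
    moreover have "\<exists>c. evolution (H2 I) z c"
      by (rule confined_evolution_exists[OF I K_def _ _ trap zK zp]) (use \<epsilon> in auto)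
    ultimately show ?thesis by blast
  qed
  show "\<exists>N. nbhd {?p} N \<and> (\<forall>z\<in>N. (\<exists>c. evolution (H2 I) z c) \<and>
      (\<forall>c. evolution (H2 I) z c \<longrightarrow> (\<forall>t. c t \<in> U)))"
    using N main by blast
qed


section \<open>Hessian at the relative equilibrium\<close>

text \<open>\<open>G\<close> is differentiable only at \<open>x\<close>, so instead of a
  second-order Taylor formula the coercivity of \<open>D\<close> gives G (x + h) . h > 0 for small
  nonzero h, and the mean value theorem on the segment finishes.\<close>

lemma second_derivative_strict_min:
  fixes F :: "'a::euclidean_space \<Rightarrow> real"
  assumes "e > 0" and F: "\<And>y. y \<in> ball x e \<Longrightarrow> (F has_derivative (\<lambda>h. G y \<bullet> h)) (at y)"
    and G: "G x = 0" "(G has_derivative D) (at x)" and D: "\<And>h. h \<noteq> 0 \<Longrightarrow> D h \<bullet> h > 0"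
  obtains \<epsilon> where "\<epsilon> > 0" "\<And>y. y \<in> cball x \<epsilon> \<Longrightarrow> y \<noteq> x \<Longrightarrow> F x < F y"
proof -
  interpret D: bounded_linear D using G(2) by (rule has_derivative_bounded_linear)
  \<comment> \<open>The minimum of the quadratic form over the unit sphere makes positive
    definiteness uniform.\<close>
  obtain m where m: "m > 0" "\<And>h. D h \<bullet> h \<ge> m * (norm h)\<^sup>2"
  proof -
    have "\<exists>u\<in>sphere (0::'a) 1. \<forall>v\<in>sphere 0 1. D u \<bullet> u \<le> D v \<bullet> v"
      by (intro continuous_attains_inf continuous_intros D.continuous_on) auto
    then obtain u where u: "norm u = 1" "\<And>v. norm v = 1 \<Longrightarrow> D u \<bullet> u \<le> D v \<bullet> v" by auto
    have "D u \<bullet> u * (norm h)\<^sup>2 \<le> D h \<bullet> h" for h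
    proof (cases "h = 0")
      case False
      have "D u \<bullet> u \<le> D (h /\<^sub>R norm h) \<bullet> (h /\<^sub>R norm h)"
        using False by (intro u(2)) simp
      then show ?thesis using False by (simp add: D.scaleR field_simps power2_eq_square)
    qed simp
    then show ?thesis using that[of "D u \<bullet> u"] D[of u] u(1) by (metis norm_zero zero_neq_one)
  qed
  obtain d where d: "d > 0" "\<And>y. norm (y - x) < d \<Longrightarrow> norm (G y - G x - D (y - x)) \<le> m / 2 * norm (y - x)"
    using G(2) m(1) unfolding has_derivative_at_alt by (meson half_gt_zero)
  have pos: "G (x + h) \<bullet> h > 0" if h: "h \<noteq> 0" "norm h < d" for h
  proof -
    have "norm (G (x + h) - D h) \<le> m / 2 * norm h" using d(2)[of "x + h"] h(2) G(1) by simp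
    from mult_right_mono[OF this, of "norm h"]
    have "\<bar>(G (x + h) - D h) \<bullet> h\<bar> \<le> m * (norm h)\<^sup>2 / 2"
      using Cauchy_Schwarz_ineq2[of "G (x + h) - D h" h] by (simp add: power2_eq_square mult.assoc)
    then have "D h \<bullet> h - G (x + h) \<bullet> h \<le> m * (norm h)\<^sup>2 / 2"
      unfolding inner_diff_left by linarith
    moreover have "m * (norm h)\<^sup>2 > 0" using m h by simp
    ultimately show ?thesis
      using m(2)[of h] by linarith
  qed
  show ?thesis
  proof
    show "min d e / 2 > 0" using d \<open>e > 0\<close> by simp
    fix y assume y: "y \<in> cball x (min d e / 2)" "y \<noteq> x"
    define h where "h = y - x"
    have h: "h \<noteq> 0" "norm h < d" "norm h < e"
      using y d \<open>e > 0\<close> by (auto simp: h_def dist_norm norm_minus_commute)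
    have sm: "norm (t *\<^sub>R h) \<le> norm h" if "0 \<le> t" "t \<le> 1" for t
      using that by (simp add: mult_left_le_one_le)
    have der: "((\<lambda>t. F (x + t *\<^sub>R h)) has_real_derivative (G (x + t *\<^sub>R h) \<bullet> h)) (at t)"
      if t: "0 \<le> t" "t \<le> 1" for t
    proof -
      have "x + t *\<^sub>R h \<in> ball x e" using sm[OF t] h(3) by (simp add: dist_norm)
      then have "((\<lambda>t. F (x + t *\<^sub>R h)) has_derivative (\<lambda>s. G (x + t *\<^sub>R h) \<bullet> (s *\<^sub>R h))) (at t)"
        by (intro has_derivative_compose[of "\<lambda>t. x + t *\<^sub>R h" _ t UNIV F]) (auto intro!: derivative_eq_intros F)
      then show ?thesis by (simp add: has_field_derivative_def mult_commute_abs mult.commute)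
    qed
    obtain t where t: "0 < t" "t < 1" "F (x + 1 *\<^sub>R h) - F (x + 0 *\<^sub>R h) = (1 - 0) * (G (x + t *\<^sub>R h) \<bullet> h)"
      using MVT2[of 0 1 "\<lambda>t. F (x + t *\<^sub>R h)" "\<lambda>t. G (x + t *\<^sub>R h) \<bullet> h"] der by auto
    have "norm (t *\<^sub>R h) < d"
      using order_le_less_trans[OF sm h(2)] t by simp
    then have "G (x + t *\<^sub>R h) \<bullet> (t *\<^sub>R h) > 0"
      by (intro pos) (use t h in auto)
    then have "G (x + t *\<^sub>R h) \<bullet> h > 0" using t by (simp add: zero_less_mult_iff)
    then show "F x < F y" using t(3) by (simp add: h_def)
  qed
qed

section \<open>Definiteness of quadratic forms in two and three variables\<close>

lemma quadratic_form2_pos: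
  fixes A B C u v :: real
  assumes "A > 0" "A * C - B\<^sup>2 > 0" "u \<noteq> 0 \<or> v \<noteq> 0"
  shows "A * u\<^sup>2 + 2 * B * u * v + C * v\<^sup>2 > 0"
proof -
  have "A * (A * u\<^sup>2 + 2 * B * u * v + C * v\<^sup>2) = (A * u + B * v)\<^sup>2 + (A * C - B\<^sup>2) * v\<^sup>2"
    by (simp add: power2_eq_square algebra_simps)
  also have "\<dots> > 0"
  proof (cases "v = 0")
    case True
    then show ?thesis using assms by simp
  next
    case False
    then have "(A * C - B\<^sup>2) * v\<^sup>2 > 0" using assms by simp
    then show ?thesis by (smt (verit) zero_le_power2)
  qed
  finally show ?thesis using assms(1) by (simp add: zero_less_mult_iff)
qed

lemma quadratic_form2_nonneg:
  fixes A B C u v :: real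
  assumes "A > 0" "A * C - B\<^sup>2 > 0"
  shows "A * u\<^sup>2 + 2 * B * u * v + C * v\<^sup>2 \<ge> 0"
  using quadratic_form2_pos[OF assms, of u v] by (cases "u = 0 \<and> v = 0") (auto simp: less_imp_le)

text \<open>Completing the square: \<open>(s, t)\<close> below solves the linear system with right-hand side \<open>(\<alpha>, \<beta>)\<close>.\<close>

lemma quadratic_form3_pos:
  fixes A B C \<alpha> \<beta> :: real
  assumes M: "A > 0" "A * C - B\<^sup>2 > 0"
  obtains K where "\<And>u v a. u \<noteq> 0 \<or> v \<noteq> 0 \<or> a \<noteq> 0 \<Longrightarrow>
    A * u\<^sup>2 + 2 * B * u * v + C * v\<^sup>2 + 2 * a * (\<alpha> * u + \<beta> * v) + K * a\<^sup>2 > 0"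
proof -
  define \<Delta> where "\<Delta> = A * C - B\<^sup>2"
  define s where "s = (C * \<alpha> - B * \<beta>) / \<Delta>"
  define t where "t = (A * \<beta> - B * \<alpha>) / \<Delta>"
  have "\<Delta> \<noteq> 0" using M by (simp add: \<Delta>_def)
  have "A * s + B * t = ((A * C - B\<^sup>2) * \<alpha>) / \<Delta>" "B * s + C * t = ((A * C - B\<^sup>2) * \<beta>) / \<Delta>"
    by (simp_all add: s_def t_def add_divide_distrib[symmetric] power2_eq_square algebra_simps)
  then have st: "\<alpha> = A * s + B * t" "\<beta> = B * s + C * t" using \<open>\<Delta> \<noteq> 0\<close> by (simp_all add: \<Delta>_def)
  show ?thesis
  proof
    fix u v a :: real assume *: "u \<noteq> 0 \<or> v \<noteq> 0 \<or> a \<noteq> 0"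
    \<comment> \<open>The witness for \<open>K\<close> is
      \<open>\<alpha> * s + \<beta> * t + 1\<close>: shifting (u, v) by \<open>a\<close> times (s,
      t) absorbs the mixed terms, and the 1 leaves a full square of \<open>a\<close>.\<close>
    have e: "A * u\<^sup>2 + 2 * B * u * v + C * v\<^sup>2 + 2 * a * (\<alpha> * u + \<beta> * v) + (\<alpha> * s + \<beta> * t + 1) * a\<^sup>2 =
      (A * (u + a * s)\<^sup>2 + 2 * B * (u + a * s) * (v + a * t) + C * (v + a * t)\<^sup>2) + a\<^sup>2"
      unfolding st by (simp add: power2_eq_square algebra_simps)
    show "A * u\<^sup>2 + 2 * B * u * v + C * v\<^sup>2 + 2 * a * (\<alpha> * u + \<beta> * v) + (\<alpha> * s + \<beta> * t + 1) * a\<^sup>2 > 0"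
    proof (cases "a = 0")
      case True
      then show ?thesis unfolding e using quadratic_form2_pos[OF M, of u v] * by simp
    next
      case False
      then have "a\<^sup>2 > 0" by simp
      then show ?thesis unfolding e using quadratic_form2_nonneg[OF M, of "u + a * s" "v + a * t"] by linarith
    qed
  qed
qed

context satellite
begin

text \<open>These are the second derivatives of the potential at \<open>R0\<close> along the
  principal axes; the mixed ones vanish because \<open>R0\<close> lies on a principal axis.\<close>

definition Vxx where "Vxx = 1 / r^3 + 3/2 * (1 / r^5) - 15/2 * I2 * (1 / r^5) + 3 * I1 * (1 / r^5)"
definition Vyy where "Vyy = - 2 / r^3 - 6 * (1 - 3 * I2) / r^5"
definition Vzz where "Vzz = 1 / r^3 + 3/2 * (1 / r^5) - 15/2 * I2 * (1 / r^5) + 3 * I3 * (1 / r^5)"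

definition hessV :: "real^3 \<Rightarrow> real^3" where
  "hessV h = vector [Vxx * h $ 1, Vyy * h $ 2, Vzz * h $ 3]"

lemma R0_inner: "R0 \<bullet> h = r * h $ 2" "h \<bullet> R0 = r * h $ 2"
  by (simp_all add: R0_def inner_vec_def sum_3)

lemma Inert_R0: "Inert *v R0 = I2 *\<^sub>R R0"
  by (simp add: R0_def Inert_def diag3_mult_vec vec_eq_iff forall_3)

lemma gradV_has_derivative: "(gradV Inert has_derivative hessV) (at R0)"
proof -
  have e: "gradV Inert = (\<lambda>R. (inverse (norm R) ^ 3 + 3/2 * inverse (norm R) ^ 5
      - 15/2 * inverse (norm R) ^ 7 * (R \<bullet> (Inert *v R))) *\<^sub>R R + (3 * inverse (norm R) ^ 5) *\<^sub>R (Inert *v R))"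
    by (simp add: gradV_def Let_def fun_eq_iff)
  have q: "inverse r * r = 1" using r_pos by simp
  have hv: "Vxx = inverse r ^ 3 + 3/2 * inverse r ^ 5 - 15/2 * I2 * inverse r ^ 5 + 3 * I1 * inverse r ^ 5"
    "Vyy = - 2 * inverse r ^ 3 - 6 * (1 - 3 * I2) * inverse r ^ 5"
    "Vzz = inverse r ^ 3 + 3/2 * inverse r ^ 5 - 15/2 * I2 * inverse r ^ 5 + 3 * I3 * inverse r ^ 5"
    by (simp_all add: Vxx_def Vyy_def Vzz_def field_simps)
  show ?thesis
    unfolding e
    apply (rule has_derivative_eq_rhs)
     apply (rule inverse_norm_has_derivative R0_nonzero derivative_eq_intros refl)+
    apply (rule ext)
    apply (simp add: norm_R0 R0_inner Inert_R0 R0_inner matrix_symmetric_inner[OF Inert_sym])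
    apply (simp add: vec_eq_iff forall_3 hessV_def hv Inert_def diag3_mult_vec)
    apply (simp add: R0_def)
    using r_pos apply (auto simp: inverse_eq_divide field_simps eval_nat_numeral)
    done
qed

definition hess :: "(real^3) \<times> (real^3) \<times> (real^3) \<Rightarrow> (real^3) \<times> (real^3) \<times> (real^3)" where
  "hess = (\<lambda>(h, a, p). let v = matrix_inv Inert *v (a - (cross3 h P0 + cross3 R0 p)) in
     (hessV h - (cross3 p \<xi> + cross3 P0 v), v, p - (cross3 v R0 + cross3 \<xi> h)))"

lemma grad_energy_has_derivative: "(grad_energy Inert has_derivative hess) (at (R0, m0, P0))"
proof -
  have e: "grad_energy Inert = (\<lambda>y. let W = matrix_inv Inert *v (fst (snd y) - cross3 (fst y) (snd (snd y))) in
     (gradV Inert (fst y) - cross3 (snd (snd y)) W, W, snd (snd y) - cross3 W (fst y)))"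
    by (auto simp: grad_energy_def angvel_def fun_eq_iff)
  have V: "((\<lambda>y. gradV Inert (fst y)) has_derivative (\<lambda>h. hessV (fst h))) (at (R0, m0, P0))"
    using has_derivative_compose[of fst fst "(R0, m0, P0)" UNIV "gradV Inert"] gradV_has_derivative
    by (simp add: bounded_linear_imp_has_derivative bounded_linear_fst)
  show ?thesis
    unfolding e Let_def
    apply (rule has_derivative_eq_rhs)
     apply (rule V derivative_eq_intros refl)+
    using angvel_0
    apply (auto simp: fun_eq_iff hess_def Let_def angvel_def algebra_simps)
    done
qed

end


section \<open>Stability and instability\<close>

context satellite
begin

text \<open>In this form the decoupling is visible: the variables group as (p3, h2, a1), (p2, h3),
  (a3, p1) and (a2, h1), which become \<open>Q1\<close> to \<open>Q4\<close> in the stability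
  proof.\<close>

lemma hess_form:
  "hess (h, a, p) \<bullet> (h, a, p) = (a$1 - r * p$3 - w * r * h$2)\<^sup>2 / I1 + (a$2 + w * r * h$1)\<^sup>2 / I2
    + (a$3 + r * p$1)\<^sup>2 / I3 - 2 * w * (h$2 * p$3 - h$3 * p$2) + (p$1)\<^sup>2 + (p$2)\<^sup>2 + (p$3)\<^sup>2
    + Vxx * (h$1)\<^sup>2 + Vyy * (h$2)\<^sup>2 + Vzz * (h$3)\<^sup>2"
  using I_pos
  by (simp add: hess_def Let_def inv_Inert diag3_mult_vec hessV_def P0_def R0_def \<xi>_def cross3_def
      inner_vec_def sum_3 field_simps power2_eq_square)

lemma w_sq_inverse: "w\<^sup>2 = 1 / r^3 + (3/2 - 9/2 * I2) * (1 / r^5)"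
  unfolding w_sq using r_pos by (simp add: field_simps)

lemma Vxx_eq: "Vxx = w\<^sup>2 + 3 * (I1 - I2) / r^5" and Vzz_eq: "Vzz = w\<^sup>2 + 3 * (I3 - I2) / r^5"
  unfolding Vxx_def Vzz_def w_sq_inverse by (simp_all add: algebra_simps add_divide_distrib diff_divide_distrib)

definition disc :: real where
  "disc = r^4 - (3 * I1 + (3 - 9 * I2) / 2) * r\<^sup>2 - 5 * ((3 - 9 * I2) / 2) * I1"

text \<open>The left side is the determinant of the Hessian in (p3, h2), the in-plane block with the
  angular momentum held fixed. It decides both stability and instability.\<close>

lemma planar_det:
  "(r\<^sup>2 / I1 + 1) * (w\<^sup>2 * r\<^sup>2 / I1 + Vyy) - (w * r\<^sup>2 / I1 - w)\<^sup>2 = disc / (I1 * r^5)"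
proof -
  have "(r\<^sup>2 / I1 + 1) * (w\<^sup>2 * r\<^sup>2 / I1 + Vyy) - (w * r\<^sup>2 / I1 - w)\<^sup>2 =
      w\<^sup>2 * (3 * r\<^sup>2 / I1 - 1) + Vyy * (r\<^sup>2 / I1 + 1)"
    using I_pos by (simp add: power2_eq_square field_simps)
  also have "\<dots> = disc / (I1 * r^5)"
    using I_pos r_pos unfolding w_sq Vyy_def disc_def by (simp add: field_simps eval_nat_numeral)
  finally show ?thesis .
qed

lemma stable:
  assumes "I1 > I3" "I3 > I2" "disc > 0"
  shows "Gmu_stable Inert (re_point Inert R0 \<xi>)"
proof -
  define J where "J = I1 + r\<^sup>2"
  have J: "J > 0" "J > I1" using I_pos r_pos by (simp_all add: J_def add_pos_pos)
  have c: "m0 \<bullet> a = J * w * a$1" "m0 = (J * w) *\<^sub>R vector [1, 0, 0]" for a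
    by (simp_all add: m0_def J_def inner_vec_def sum_3 vec_eq_iff forall_3)
  have "r\<^sup>2 / I1 + 1 > 0" "(r\<^sup>2 / I1 + 1) * (w\<^sup>2 * r\<^sup>2 / I1 + Vyy) - (w * r\<^sup>2 / I1 - w)\<^sup>2 > 0"
    unfolding planar_det using I_pos r_pos assms by (simp_all add: add_pos_pos)
  \<comment> \<open>The linear terms in \<open>a\<close> are the cross terms of the first square in
    \<open>hess_form\<close>; \<open>K\<close> is a coefficient of the square of a1 large enough for
    this block.\<close>
  then obtain K where K: "\<And>u v a. u \<noteq> 0 \<or> v \<noteq> 0 \<or> a \<noteq> 0 \<Longrightarrow>
    (r\<^sup>2 / I1 + 1) * u\<^sup>2 + 2 * (w * r\<^sup>2 / I1 - w) * u * v + (w\<^sup>2 * r\<^sup>2 / I1 + Vyy) * v\<^sup>2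
      + 2 * a * ((- r / I1) * u + (- w * r / I1) * v) + K * a\<^sup>2 > 0"
    using quadratic_form3_pos[where \<alpha> = "- r / I1" and \<beta> = "- w * r / I1"] by metis
  \<comment> \<open>Solves 1 / I1 - 1 / J + 2 C (J w)^2 = K, the left side being the coefficient of
    the square of a1 in the Hessian of \<open>F\<close>.\<close>
  define C where "C = (K - 1 / I1 + 1 / J) / (2 * (J * w)\<^sup>2)"
  have C: "2 * C * (J * w)\<^sup>2 = K - 1 / I1 + 1 / J" using J w_pos by (simp add: C_def)
  define \<phi> where "\<phi> = (\<lambda>(a, b). a - 1 / (2 * J) * b + C / 4 * (b - m0 \<bullet> m0)\<^sup>2)"
  define F where "F y = \<phi> (energy Inert y, fst (snd y) \<bullet> fst (snd y))" for y
  define G where "G y = grad_energy Inert y + (0, (C * (fst (snd y) \<bullet> fst (snd y) - m0 \<bullet> m0) - 1 / J) *\<^sub>R fst (snd y), 0)" for y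
  define D where "D h = hess h + (0, (2 * C * (m0 \<bullet> fst (snd h))) *\<^sub>R m0 - (1 / J) *\<^sub>R fst (snd h), 0)" for h
  have F': "(F has_derivative (\<lambda>h. G y \<bullet> h)) (at y)" if "y \<in> ball (R0, m0, P0) r" for y
  proof -
    have "fst y \<noteq> 0"
      using that norm_R0 dist_fst_le[of "(R0, m0, P0)" y] by (auto simp: dist_norm)
    note E = energy_has_derivative[OF Inert_sym Inert_inv this]
    show ?thesis
      unfolding F_def \<phi>_def prod.case
      apply (rule has_derivative_eq_rhs)
       apply (rule E derivative_eq_intros refl)+
      using J
      apply (auto simp: fun_eq_iff G_def inner_add_left)
      apply (simp add: inner_commute field_simps)
      done
  qed
  have G': "(G has_derivative D) (at (R0, m0, P0))"
    unfolding G_def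
    apply (rule has_derivative_eq_rhs)
     apply (rule grad_energy_has_derivative derivative_eq_intros refl)+
    apply (auto simp: fun_eq_iff D_def hess_def Let_def inner_commute algebra_simps)
    done
  have G0: "G (R0, m0, P0) = 0"
    using J equilibrium_fixed(1)
    by (simp add: G_def grad_energy_def angvel_0 gradV_0 zero_prod_def)
       (simp add: J_def m0_def \<xi>_def vec_eq_iff forall_3)
  have D: "D y \<bullet> y > 0" if "y \<noteq> 0" for y
  proof -
    obtain h a p where y: "y = (h, a, p)" by (cases y)
    define Q1 where "Q1 = (r\<^sup>2 / I1 + 1) * (p$3)\<^sup>2 + 2 * (w * r\<^sup>2 / I1 - w) * p$3 * h$2 + (w\<^sup>2 * r\<^sup>2 / I1 + Vyy) * (h$2)\<^sup>2
      + 2 * a$1 * ((- r / I1) * p$3 + (- w * r / I1) * h$2) + K * (a$1)\<^sup>2"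
    define Q2 where "Q2 = 1 * (p$2)\<^sup>2 + 2 * w * p$2 * h$3 + Vzz * (h$3)\<^sup>2"
    define Q3 where "Q3 = (1 / I3 - 1 / J) * (a$3)\<^sup>2 + 2 * (r / I3) * a$3 * p$1 + (r\<^sup>2 / I3 + 1) * (p$1)\<^sup>2"
    define Q4 where "Q4 = (1 / I2 - 1 / J) * (a$2)\<^sup>2 + 2 * (w * r / I2) * a$2 * h$1 + (w\<^sup>2 * r\<^sup>2 / I2 + Vxx) * (h$1)\<^sup>2"
    have "(2 * C * (m0 \<bullet> a)) *\<^sub>R m0 \<bullet> a = (K - 1 / I1 + 1 / J) * (a$1)\<^sup>2"
      unfolding C[symmetric] by (simp add: c(1) power2_eq_square)
    then have Q: "D y \<bullet> y = Q1 + Q2 + Q3 + Q4"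
      using I_pos J
      by (simp add: D_def y inner_add_left inner_diff_left hess_form)
        (simp add: Q1_def Q2_def Q3_def Q4_def inner_vec_def[of a a] sum_3 power2_eq_square field_simps)
    have Q1: "Q1 > 0" if "p$3 \<noteq> 0 \<or> h$2 \<noteq> 0 \<or> a$1 \<noteq> 0"
      using K[OF that] by (simp add: Q1_def)
    have Q1': "Q1 \<ge> 0"
      using Q1 by (cases "p$3 \<noteq> 0 \<or> h$2 \<noteq> 0 \<or> a$1 \<noteq> 0") (auto simp: Q1_def less_imp_le)
    \<comment> \<open>Each remaining block rests on one inequality: I3 > I2 here, I1 > I3 in
      \<open>M3\<close>, and I1 > I2 in \<open>M4\<close>.\<close>
    have M2: "1 * Vzz - w\<^sup>2 > 0"
      unfolding Vzz_eq using assms r_pos by simp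
    have M3: "1 / I3 - 1 / J > 0" "(1 / I3 - 1 / J) * (r\<^sup>2 / I3 + 1) - (r / I3)\<^sup>2 > 0"
    proof -
      show "1 / I3 - 1 / J > 0" using I_pos J assms by (simp add: field_simps)
      have "(1 / I3 - 1 / J) * (r\<^sup>2 / I3 + 1) - (r / I3)\<^sup>2 = (I1 - I3) / (I3 * J)"
        using I_pos J by (simp add: field_simps power2_eq_square) (simp add: J_def power2_eq_square algebra_simps)
      also have "\<dots> > 0" using I_pos J assms by simp
      finally show "(1 / I3 - 1 / J) * (r\<^sup>2 / I3 + 1) - (r / I3)\<^sup>2 > 0" .
    qed
    have M4: "1 / I2 - 1 / J > 0" "(1 / I2 - 1 / J) * (w\<^sup>2 * r\<^sup>2 / I2 + Vxx) - (w * r / I2)\<^sup>2 > 0"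
    proof -
      show "1 / I2 - 1 / J > 0" using I_pos J assms by (simp add: field_simps)
      define e where "e = 3 * (I1 - I2) / r^5"
      have e: "e > 0" using assms r_pos by (simp add: e_def)
      have "(1 / I2 - 1 / J) * (w\<^sup>2 * r\<^sup>2 / I2 + Vxx) - (w * r / I2)\<^sup>2 =
          (w\<^sup>2 * (I1 - I2) + e * (J - I2)) / (I2 * J)"
        unfolding Vxx_eq e_def[symmetric] using I_pos J
        by (simp add: field_simps power2_eq_square) (simp add: J_def power2_eq_square algebra_simps)
      also have "\<dots> > 0" using I_pos J assms e w_pos by (intro divide_pos_pos add_pos_pos mult_pos_pos) auto
      finally show "(1 / I2 - 1 / J) * (w\<^sup>2 * r\<^sup>2 / I2 + Vxx) - (w * r / I2)\<^sup>2 > 0" .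
    qed
    note nonneg = Q1' quadratic_form2_nonneg[OF zero_less_one M2, of "p$2" "h$3", folded Q2_def]
      quadratic_form2_nonneg[OF M3, of "a$3" "p$1", folded Q3_def]
      quadratic_form2_nonneg[OF M4, of "a$2" "h$1", folded Q4_def]
    have "p$3 \<noteq> 0 \<or> h$2 \<noteq> 0 \<or> a$1 \<noteq> 0 \<or> p$2 \<noteq> 0 \<or> h$3 \<noteq> 0 \<or> a$3 \<noteq> 0 \<or> p$1 \<noteq> 0 \<or> a$2 \<noteq> 0 \<or> h$1 \<noteq> 0"
      using that by (auto simp: y zero_prod_def vec_eq_iff forall_3)
    then have "Q1 > 0 \<or> Q2 > 0 \<or> Q3 > 0 \<or> Q4 > 0"
      using Q1 quadratic_form2_pos[OF zero_less_one M2, of "p$2" "h$3", folded Q2_def]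
        quadratic_form2_pos[OF M3, of "a$3" "p$1", folded Q3_def]
        quadratic_form2_pos[OF M4, of "a$2" "h$1", folded Q4_def] by metis
    then show ?thesis using nonneg unfolding Q by linarith
  qed
  obtain \<epsilon> where \<epsilon>: "\<epsilon> > 0" "\<And>y. y \<in> cball (R0, m0, P0) \<epsilon> \<Longrightarrow> y \<noteq> (R0, m0, P0) \<Longrightarrow> F (R0, m0, P0) < F y"
    using second_derivative_strict_min[OF r_pos F' G0 G' D] by metis
  show ?thesis
    unfolding re_point_eq
  proof (rule Gmu_stableI[OF Inert_sym Inert_inv R0_nonzero])
    show "continuous_on UNIV \<phi>"
      unfolding \<phi>_def case_prod_unfold using J by (intro continuous_intros) auto
    show "\<epsilon> > 0" by (rule \<epsilon>(1))
  qed (use \<epsilon>(2) in \<open>auto simp: F_def\<close>)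
qed

end

section \<open>Linear instability below the critical radius\<close>

lemma real_eigenvector_2x2:
  fixes a b c d :: real
  assumes "a * d - b * c < 0"
  obtains l u v where "l > 0" "u \<noteq> 0 \<or> v \<noteq> 0" "a * u + b * v = l * u" "c * u + d * v = l * v"
proof -
  \<comment> \<open>With a negative determinant the discriminant exceeds the square of the trace, so
    the larger root \<open>l\<close> is positive.\<close>
  define s where "s = sqrt ((a + d)\<^sup>2 - 4 * (a * d - b * c))"
  have "4 * (a * d - b * c) \<le> (a + d)\<^sup>2"
    by (rule order_trans[of _ 0]) (use assms in auto)
  then have s2: "s\<^sup>2 = (a + d)\<^sup>2 - 4 * (a * d - b * c)" by (simp add: s_def)
  have "\<bar>a + d\<bar> < s" unfolding s_def using assms by (intro real_less_rsqrt) simp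
  define l where "l = (a + d + s) / 2"
  have l: "l > 0" "(l - a) * (l - d) = b * c"
    using \<open>\<bar>a + d\<bar> < s\<close> s2 by (auto simp: l_def power2_eq_square field_simps)
  show ?thesis
  \<comment> \<open>The first row gives the eigenvector (b, l - a) unless it vanishes; then the
    second row gives (l - d, c), nonzero because a d < 0 forces d to differ from l = a.\<close>
  proof (cases "b = 0 \<and> l = a")
    case True
    then have "d \<noteq> a" using assms by (auto simp: mult_less_0_iff)
    then show ?thesis
      using that[of l "l - d" c] l True by (simp add: algebra_simps)
  next
    case False
    then show ?thesis
      using that[of l b "l - a"] l by (simp add: algebra_simps)
  qed
qed

context satellite
begin

text \<open>The explicit formula \<open>f\<close> is differentiable in the ambient space and agrees
  with the field on the phase space. At the equilibrium \<open>hat\<close> is applied to zero, so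
  varying its left factor \<open>B\<close> contributes nothing.\<close>

lemma augmented_has_derivative:
  "(ham_field (\<lambda>z. H2 Inert z - momentum z \<bullet> \<xi>) has_derivative
     (\<lambda>(b, h, a, p). case hess (h, a, p) of (x, v, y) \<Rightarrow>
        (hat (v - transpose b *v \<xi>), y, cross3 a \<xi> + cross3 m0 v, - x)))
   (at (mat 1, R0, m0, P0) within phase_space)"
proof -
  define f where "f z = (fst z ** hat (matrix_inv Inert *v (fst (snd (snd z)) - cross3 (fst (snd z)) (snd (snd (snd z))))
      - transpose (fst z) *v \<xi>),
    snd (snd (grad_energy Inert (snd z))), cross3 (fst (snd (snd z))) (fst (snd (grad_energy Inert (snd z)))),
    - fst (grad_energy Inert (snd z)))" for z
  have G: "((\<lambda>z. grad_energy Inert (snd z)) has_derivative (\<lambda>h. hess (snd h))) (at (mat 1, R0, m0, P0))"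
    using has_derivative_compose[of snd snd "(mat 1, R0, m0, P0)" UNIV "grad_energy Inert"]
      grad_energy_has_derivative
    by (simp add: bounded_linear_imp_has_derivative bounded_linear_snd)
  have \<xi>: "matrix_inv Inert *v (m0 - cross3 R0 P0) = \<xi>"
    using angvel_0 by (simp add: angvel_def)
  have "(f has_derivative
     (\<lambda>(b, h, a, p). case hess (h, a, p) of (x, v, y) \<Rightarrow>
        (hat (v - transpose b *v \<xi>), y, cross3 a \<xi> + cross3 m0 v, - x))) (at (mat 1, R0, m0, P0))"
    unfolding f_def
    apply (rule has_derivative_eq_rhs)
     apply (rule G derivative_eq_intros bounded_linear.has_derivative[OF bounded_linear_transpose] refl)+
    apply (rule ext)
    apply (auto simp: \<xi> hess_def Let_def transpose_mat grad_energy_def angvel_0 add.commute)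
    done
  then have "(f has_derivative
     (\<lambda>(b, h, a, p). case hess (h, a, p) of (x, v, y) \<Rightarrow>
        (hat (v - transpose b *v \<xi>), y, cross3 a \<xi> + cross3 m0 v, - x))) (at (mat 1, R0, m0, P0) within phase_space)"
    by (rule has_derivative_at_withinI)
  then show ?thesis
  proof (rule has_derivative_transform_within)
    show "(mat 1, R0, m0, P0) \<in> phase_space"
      by (simp add: phase_space_def rotation_matrix_def orthogonal_matrix_id)
    fix z :: phase assume z: "z \<in> phase_space"
    obtain B R m P where zB: "z = (B, R, m, P)" by (cases z)
    have "R \<noteq> 0" using z zB by (simp add: phase_space_def)
    from ham_field_augmented[OF Inert_sym Inert_inv this refl, where m = m and P = P and \<xi> = \<xi> and B = B]
    show "f z = ham_field (\<lambda>z. H2 Inert z - momentum z \<bullet> \<xi>) z"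
      by (simp add: f_def zB grad_energy_def Let_def) (simp add: angvel_def)
  qed (rule zero_less_one)
qed

lemma unstable:
  assumes "I3 > I2" "disc < 0"
  shows "linearly_unstable Inert (re_point Inert R0 \<xi>) \<xi>"
proof -
  define a where "a = w * r\<^sup>2 / I1 - w"
  define b where "b = r\<^sup>2 / I1 + 1"
  define c where "c = w\<^sup>2 * r\<^sup>2 / I1 + Vyy"
  have "b * c - a\<^sup>2 < 0"
    unfolding a_def b_def c_def planar_det using assms I_pos r_pos by (simp add: divide_neg_pos)
  moreover have "Vzz - w\<^sup>2 > 0" using assms r_pos by (simp add: Vzz_eq)
  \<comment> \<open>This product equals the determinant of the matrix of the second-order system
    introduced next.\<close>
  ultimately have "(b * c - a\<^sup>2) * (Vzz - w\<^sup>2) < 0"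
    by (simp add: mult_neg_pos)
  txt \<open>The matrix of \<open>(y, s)''\<close> for the planar motion, where \<open>y' = w z + q\<close>, \<open>s' = - Vzz z - w q\<close>,
    \<open>z' = a y + b s\<close>, \<open>q' = - c y - a s\<close>.\<close>
  then have "(w * a - c) * (a * w - Vzz * b) - (w * b - a) * (w * c - Vzz * a) < 0"
    by (simp add: algebra_simps power2_eq_square)
  then obtain l y s where l: "l > 0" "y \<noteq> 0 \<or> s \<noteq> 0"
      "(w * a - c) * y + (w * b - a) * s = l * y" "(w * c - Vzz * a) * y + (a * w - Vzz * b) * s = l * s"
    by (rule real_eigenvector_2x2)
  define \<sigma> where "\<sigma> = sqrt l"
  have \<sigma>: "\<sigma> > 0" "\<sigma> * \<sigma> = l" using l(1) by (simp_all add: \<sigma>_def)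
  \<comment> \<open>An eigenvector of the squared system for \<open>l\<close> is completed to one of
    the first-order system for \<open>\<sigma>\<close> by dividing the equations for z' and q' by
    \<open>\<sigma>\<close>.\<close>
  define z where "z = (a * y + b * s) / \<sigma>"
  define q where "q = - (c * y + a * s) / \<sigma>"
  have zq: "a * y + b * s = \<sigma> * z" "- c * y - a * s = \<sigma> * q"
    using \<sigma>(1) by (simp_all add: z_def q_def)
  have "\<sigma> * (w * z + q) = w * (\<sigma> * z) + \<sigma> * q" "\<sigma> * (- Vzz * z - w * q) = - Vzz * (\<sigma> * z) - w * (\<sigma> * q)"
    by (simp_all add: algebra_simps)
  then have "\<sigma> * (w * z + q) = \<sigma> * (\<sigma> * y)" "\<sigma> * (- Vzz * z - w * q) = \<sigma> * (\<sigma> * s)"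
    using l(3,4) unfolding zq[symmetric] mult.assoc[symmetric] \<sigma>(2) by (simp_all add: algebra_simps)
  then have eig: "w * z + q = \<sigma> * y" "- Vzz * z - w * q = \<sigma> * s"
    using \<sigma>(1) by (simp_all del: right_diff_distrib)
  note eig = eig zq
  define h where "h = (vector [0, y, z] :: real^3)"
  define p where "p = (vector [0, q, s] :: real^3)"
  \<comment> \<open>With zero attitude and zero \<open>m\<close> component the vector is killed by
    the derivative of \<open>b *v m0 + a\<close>, hence lies in the kernel of the momentum
    derivative.\<close>
  define u where "u = (0 :: real^3^3, h, 0 :: real^3, p)"
  define v where "v = matrix_inv Inert *v (- (cross3 h P0 + cross3 R0 p))"
  define n where "n = (r * s + w * r * y) / I1"
  have v: "v = vector [- n, 0, 0]"
    using I_pos by (simp add: v_def n_def h_def p_def inv_Inert diag3_mult_vec R0_def P0_def cross3_def vec_eq_iff forall_3 field_simps)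
  have n: "r * n = (a + w) * y + (b - 1) * s"
    using I_pos by (simp add: n_def a_def b_def power2_eq_square field_simps)
  have b: "w * b = a + 2 * w" by (simp add: a_def b_def algebra_simps)
  have Vyy: "Vyy = c - w * (a + w)" by (simp add: c_def a_def power2_eq_square)
  have hess: "hess (h, 0, p) = (- (\<sigma> *\<^sub>R p), v, \<sigma> *\<^sub>R h)"
  proof -
    have "s + r * n - w * y = \<sigma> * z" using eig(3) unfolding n by (simp add: algebra_simps)
    then have "p - (cross3 v R0 + cross3 \<xi> h) = \<sigma> *\<^sub>R h"
      using eig(1)
      by (simp add: v p_def h_def R0_def \<xi>_def cross3_def vec_eq_iff forall_3 algebra_simps)
    moreover have "Vyy * y - w * s + w * (r * n) = - (\<sigma> * q)"
      using eig(4) b unfolding n Vyy by (simp add: algebra_simps, algebra)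
    then have "hessV h - (cross3 p \<xi> + cross3 P0 v) = - (\<sigma> *\<^sub>R p)"
      using eig(2)
      by (simp add: v p_def h_def P0_def \<xi>_def hessV_def cross3_def vec_eq_iff forall_3 algebra_simps)
    ultimately show ?thesis by (simp add: hess_def Let_def v_def)
  qed
  let ?p = "(mat 1 :: real^3^3, R0, m0, P0)"
  let ?L = "\<lambda>(b, h, a, p). case hess (h, a, p) of (x, v, y) \<Rightarrow>
        (hat (v - transpose b *v \<xi>), y, cross3 a \<xi> + cross3 m0 v, - x)"
  have m0v: "cross3 m0 v = 0" by (simp add: m0_def v cross3_def vec_eq_iff forall_3)
  have zero: "transpose (0 :: real^3^3) = 0" by (simp add: transpose_def vec_eq_iff)
  have Lu: "?L u = (hat v, \<sigma> *\<^sub>R h, 0, \<sigma> *\<^sub>R p)"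
    by (simp add: u_def hess m0v zero)
  have orbit: "gmu_orbit ?p = {(hat \<zeta>, 0, 0, 0) | \<zeta>. cross3 \<zeta> m0 = 0}"
    by (simp add: gmu_orbit_def)
  have mom: "frechet_derivative momentum (at ?p) = (\<lambda>(b, r, a, p). b *v m0 + mat 1 *v a)"
    by (rule frechet_derivative_at[symmetric, OF momentum_has_derivative])
  have ker: "u \<in> ker_dJ ?p" "0 \<in> ker_dJ ?p"
  proof -
    have "u = tangent ?p (0, h, 0, p)" "0 = tangent ?p 0"
      by (simp_all add: u_def zero_prod_def)
    then have "u \<in> range (tangent ?p)" "0 \<in> range (tangent ?p)" by (metis rangeI)+
    then show "u \<in> ker_dJ ?p" "0 \<in> ker_dJ ?p"
      unfolding ker_dJ_def mom by (simp_all add: u_def zero_prod_def)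
  qed
  have "h \<noteq> 0 \<or> p \<noteq> 0" using l(2) by (auto simp: h_def p_def vec_eq_iff forall_3)
  then have nu: "u \<notin> gmu_orbit ?p" by (auto simp: orbit u_def)
  \<comment> \<open>This is the error in the eigenvector equation. Since \<open>v\<close> is
    parallel to \<open>m0\<close>, it is an infinitesimal rotation fixing the momentum and vanishes
    in the quotient.\<close>
  have "(hat v, 0, 0, 0) \<in> gmu_orbit ?p"
    using m0v cross_skew[of v m0] by (auto simp: orbit)
  moreover have "(hat v, 0, 0, 0) = ?L u - (Re (of_real \<sigma>) *\<^sub>R u - Im (of_real \<sigma>) *\<^sub>R 0)"
    unfolding Lu by (simp add: u_def zero_prod_def)
  moreover have "(hat 0, 0, 0, 0) \<in> gmu_orbit ?p" unfolding orbit using cross_zero_left by blast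
  then have "0 \<in> gmu_orbit ?p" by (simp add: zero_prod_def)
  moreover have "?L 0 = 0"
    using augmented_has_derivative by (rule linear_simps(3)[OF has_derivative_bounded_linear])
  ultimately have "quotient_eigenvalue ?L (ker_dJ ?p) (gmu_orbit ?p) (of_real \<sigma>)"
    unfolding quotient_eigenvalue_def
    by (intro bexI[OF _ ker(1)] bexI[OF _ ker(2)]) (use nu in simp)
  then show ?thesis
    unfolding linearly_unstable_def re_point_eq using augmented_has_derivative \<sigma>(1)
    by (intro exI[of _ ?L] exI[of _ "of_real \<sigma>"]) simp
qed

end

theorem proposition3p8:
  fixes I1 I2 I3 :: real
  assumes "0 < I1" "I1 < 1/2" "0 < I2" "I2 < 1/2" "0 < I3" "I3 < 1/2"
    and "I1 + I2 + I3 = 1"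
    and "I1 > I3" "I3 > I2"
  shows "\<exists>Rcrit>0. Rcrit < 2 \<and>
    (\<forall>R>0. \<forall>\<xi>1>0. \<xi>1\<^sup>2 = 1 / R^3 + (3 - 9 * I2) / (2 * R^5) \<longrightarrow>
      (let I = diag3 I1 I2 I3; Rv = vector [0, R, 0] :: real^3;
           \<xi> = vector [\<xi>1, 0, 0] :: real^3; p = re_point I Rv \<xi> in
        relative_equilibrium I p \<xi> \<and> orthogonal Rv \<xi> \<and>
        (R > Rcrit \<longrightarrow> Gmu_stable I p) \<and>
        (R < Rcrit \<longrightarrow> linearly_unstable I p \<xi>)))"
proof -
  define k where "k = (3 - 9 * I2) / 2"
  \<comment> \<open>Positivity amounts to I2 < 1/3, which holds because I2 is the least of three
    numbers with sum 1.\<close>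
  have k: "0 < k" "k < 3/2" using assms by (simp_all add: k_def)
  define b where "b = 3 * I1 + k"
  define c where "c = 5 * k * I1"
  have bc: "b > 0" "c > 0" using k assms by (simp_all add: b_def c_def)
  define s where "s = sqrt (b\<^sup>2 + 4 * c)"
  have s: "s\<^sup>2 = b\<^sup>2 + 4 * c" "s > b" "s > 0"
    using bc by (auto simp: s_def intro!: real_less_rsqrt add_pos_pos)
  define T where "T = (b + s) / 2"
  have T: "T > 0" using s bc by (simp add: T_def)
  have fac: "t\<^sup>2 - b * t - c = (t - T) * (t + (s - b) / 2)" for t
    using s(1) by (simp add: T_def power2_eq_square field_simps)
  have "T < 4"
  proof -
    \<comment> \<open>At t = 4 the polynomial is 16 - 12 I1 - 4 k - 5 k I1, which exceeds 16 - 6 - 6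
      - 15/4 = 1/4.\<close>
    have "k * I1 < 3/2 * (1/2)" using k assms by (intro mult_strict_mono) auto
    then have "4\<^sup>2 - b * 4 - c > 0" using k assms by (simp add: b_def c_def)
    then have "0 < (4 - T) * (4 + (s - b) / 2)" unfolding fac .
    then have "0 < 4 - T" by (rule zero_less_mult_pos2) (use s(2) in \<open>simp add: field_simps\<close>)
    then show ?thesis by simp
  qed
  show ?thesis
  proof (intro exI[of _ "sqrt T"] conjI allI impI)
    show "sqrt T > 0" using T by simp
    show "sqrt T < 2" using \<open>T < 4\<close> by (simp add: real_less_lsqrt)
    fix R w :: real
    assume R: "R > 0" and w: "w > 0" "w\<^sup>2 = 1 / R^3 + (3 - 9 * I2) / (2 * R^5)"
    interpret satellite I1 I2 I3 R w by standard (use assms R w in auto)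
    have "disc = (R\<^sup>2)\<^sup>2 - b * R\<^sup>2 - c"
      by (simp add: disc_def b_def c_def k_def)
    then have disc: "disc = (R\<^sup>2 - T) * (R\<^sup>2 + (s - b) / 2)" by (simp only: fac)
    \<comment> \<open>The other root of the quadratic is negative, so only the factor
      \<open>R\<^sup>2 - T\<close> determines the sign of \<open>disc\<close>.\<close>
    have pos: "R\<^sup>2 + (s - b) / 2 > 0" using s R by (simp add: add_pos_pos)
    have "disc > 0" if "R > sqrt T"
    proof -
      have "R\<^sup>2 > T" using that T real_sqrt_less_iff[of T "R\<^sup>2"] R by simp
      then show ?thesis using pos by (simp add: disc)
    qed
    moreover have "disc < 0" if "R < sqrt T"
    proof -
      have "R\<^sup>2 < T" using that T real_sqrt_less_iff[of "R\<^sup>2" T] R by simp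
      then show ?thesis using pos by (simp add: disc mult_neg_pos)
    qed
    moreover have "orthogonal R0 \<xi>" by (simp add: R0_def \<xi>_def orthogonal_def inner_vec_def sum_3)
    ultimately show "let I = diag3 I1 I2 I3; Rv = vector [0, R, 0] :: real^3;
           \<xi> = vector [w, 0, 0] :: real^3; p = re_point I Rv \<xi> in
        relative_equilibrium I p \<xi> \<and> orthogonal Rv \<xi> \<and>
        (R > sqrt T \<longrightarrow> Gmu_stable I p) \<and>
        (R < sqrt T \<longrightarrow> linearly_unstable I p \<xi>)"
      using relative_equilibrium stable unstable assms
      by (simp add: Let_def flip: Inert_def R0_def \<xi>_def)
  qed
qed

end
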